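(* Let $K\ge 1$ and $k=\frac{K-1}{K+1}$, so that $k\in[0,1)$. Suppose that $f(z)=h(z)+\overline{g(z)}=\sum_{n=0}^{\infty}a_nz^n+\overline{\sum_{n=1}^{\infty}b_nz^n}$ is a $K$-quasiconformal sense-preserving harmonic mapping in $\mathbb{D}$, where $h$ is a bounded analytic function in $\mathbb{D}$, and put $\|h\|_\infty=\sup_{z\in\mathbb{D}}|h(z)|$. (1) Then $$|h(z)|+\sum_{n=1}^{\infty}(|a_n|+|b_n|)r^n\le \|h\|_\infty\quad\text{for } |z|=r\le r_1(k),$$ where $r_1(k)$ is the unique root of the equation $2(k+1)r(1+r)-(1-r)^2=0$ in the interval $(0,1)$. The radius $r_1(k)$ is sharp. (2) Moreover, $$|h(z)|^2+\sum_{n=1}^{\infty}(|a_n|+|b_n|)r^n\le \|h\|_\infty\quad\text{for } |z|=r\le r_2(k),$$ where $r_2(k)$ is the unique root of the equation $(k+1)r(1+r)-(1-r)^2=0$ in the interval $(0,1)$. The radius $r_2(k)$ is sharp.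
   Context: $\mathbb{D}=\{z\in\mathbb{C}:|z|<1\}$. A harmonic mapping $f=h+\overline{g}$ in $\mathbb{D}$ ($h,g$ analytic, $g(0)=0$) is sense-preserving if $J_f=|h'|^2-|g'|^2>0$ in $\mathbb{D}$, equivalently $h'\neq0$ and the dilatation $\omega_f=g'/h'$ satisfies $|\omega_f|<1$ in $\mathbb{D}$. A sense-preserving homeomorphism $f$ of $\mathbb{D}$ onto a domain, in the Sobolev class $W^{1,2}_{loc}(\mathbb{D})$, is $K$-quasiconformal if $\frac{|f_z|+|f_{\bar z}|}{|f_z|-|f_{\bar z}|}=\frac{1+|\omega_f(z)|}{1-|\omega_f(z)|}\le K$ in $\mathbb{D}$, i.e. $|\omega_f(z)|\le k=\frac{K-1}{K+1}$. "Sharp" means that the radius cannot be replaced by any larger number.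
   Formalization: Part (2), both the inequality and its sharpness, is stated for mappings with ‖h‖_∞ ≤ 1, since as printed it fails for every norm above 1 (e.g. h(z) = 1.9 + 0.1z, g = 0 at z = 0). *)

theory Defs
  imports "HOL-Analysis.Analysis"
begin

abbreviation unit_disc :: "complex set" where
  "unit_disc \<equiv> ball 0 1"


text \<open>Infinitely differentiable functions on the plane: \<open>D i j\<close> is the partial derivative taken
  \<open>i\<close> times in the real and \<open>j\<close> times in the imaginary direction.\<close>

definition smooth_on_plane :: "(complex \<Rightarrow> real) \<Rightarrow> bool" where
  "smooth_on_plane \<phi> \<longleftrightarrow>
     (\<exists>D :: nat \<Rightarrow> nat \<Rightarrow> complex \<Rightarrow> real. D 0 0 = \<phi> \<and>
        (\<forall>i j z. (D i j has_derivative
                   (\<lambda>v. D (Suc i) j z * Re v + D i (Suc j) z * Im v)) (at z)))"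

definition test_function :: "complex set \<Rightarrow> (complex \<Rightarrow> real) \<Rightarrow> bool" where
  "test_function U \<phi> \<longleftrightarrow> smooth_on_plane \<phi> \<and>
     compact (closure {z. \<phi> z \<noteq> 0}) \<and> closure {z. \<phi> z \<noteq> 0} \<subseteq> U"

definition L2_loc :: "complex set \<Rightarrow> (complex \<Rightarrow> complex) \<Rightarrow> bool" where
  "L2_loc U f \<longleftrightarrow> f \<in> borel_measurable (lebesgue_on U) \<and>
     (\<forall>C. compact C \<and> C \<subseteq> U \<longrightarrow> set_integrable lebesgue C (\<lambda>z. (norm (f z))\<^sup>2))"

definition weak_directional_deriv ::
    "complex set \<Rightarrow> complex \<Rightarrow> (complex \<Rightarrow> complex) \<Rightarrow> (complex \<Rightarrow> complex) \<Rightarrow> bool" where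
  "weak_directional_deriv U v f p \<longleftrightarrow>
     (\<forall>\<phi>. test_function U \<phi> \<longrightarrow>
        (LINT z:U|lebesgue. frechet_derivative \<phi> (at z) v *\<^sub>R f z) =
        - (LINT z:U|lebesgue. \<phi> z *\<^sub>R p z))"

definition W12_loc :: "complex set \<Rightarrow> (complex \<Rightarrow> complex) \<Rightarrow> bool" where
  "W12_loc U f \<longleftrightarrow> L2_loc U f \<and>
     (\<exists>p q. L2_loc U p \<and> L2_loc U q \<and>
        weak_directional_deriv U 1 f p \<and> weak_directional_deriv U \<i> f q)"


definition harmonic_map ::
    "(complex \<Rightarrow> complex) \<Rightarrow> (complex \<Rightarrow> complex) \<Rightarrow> complex \<Rightarrow> complex" where
  "harmonic_map h g z = h z + cnj (g z)"

definition sense_preserving_harmonic ::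
    "(complex \<Rightarrow> complex) \<Rightarrow> (complex \<Rightarrow> complex) \<Rightarrow> bool" where
  "sense_preserving_harmonic h g \<longleftrightarrow>
     h holomorphic_on unit_disc \<and> g holomorphic_on unit_disc \<and> g 0 = 0 \<and>
     (\<forall>z\<in>unit_disc. (norm (deriv h z))\<^sup>2 - (norm (deriv g z))\<^sup>2 > 0)"

text \<open>The Wirtinger derivatives \<open>(f\<^sub>x - \<i> f\<^sub>y) / 2\<close> and \<open>(f\<^sub>x + \<i> f\<^sub>y) / 2\<close>.\<close>

definition wirtinger :: "(complex \<Rightarrow> complex) \<Rightarrow> complex \<Rightarrow> complex" where
  "wirtinger f z =
     (frechet_derivative f (at z) 1 - \<i> * frechet_derivative f (at z) \<i>) / 2"

definition wirtinger_bar :: "(complex \<Rightarrow> complex) \<Rightarrow> complex \<Rightarrow> complex" where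
  "wirtinger_bar f z =
     (frechet_derivative f (at z) 1 + \<i> * frechet_derivative f (at z) \<i>) / 2"

text \<open>Harmonic maps are smooth, so the distortion inequality is required at every point of the
  disc, with classical derivatives. Its denominator is positive for sense-preserving maps.\<close>

definition quasiconformal_harmonic ::
    "real \<Rightarrow> (complex \<Rightarrow> complex) \<Rightarrow> (complex \<Rightarrow> complex) \<Rightarrow> bool" where
  "quasiconformal_harmonic K h g \<longleftrightarrow>
     sense_preserving_harmonic h g \<and>
     (\<exists>V f'. open V \<and> connected V \<and> homeomorphism unit_disc V (harmonic_map h g) f') \<and>
     W12_loc unit_disc (harmonic_map h g) \<and>
     (\<forall>z\<in>unit_disc.
        (norm (wirtinger (harmonic_map h g) z) + norm (wirtinger_bar (harmonic_map h g) z)) /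
        (norm (wirtinger (harmonic_map h g) z) - norm (wirtinger_bar (harmonic_map h g) z)) \<le> K)"

text \<open>The value \<open>b 0\<close> is irrelevant: the expansion of \<open>g\<close> starts with the linear term.\<close>

definition qc_harmonic_series ::
    "real \<Rightarrow> (nat \<Rightarrow> complex) \<Rightarrow> (nat \<Rightarrow> complex) \<Rightarrow> (complex \<Rightarrow> complex) \<Rightarrow> (complex \<Rightarrow> complex) \<Rightarrow> bool"
  where
  "qc_harmonic_series K a b h g \<longleftrightarrow>
     quasiconformal_harmonic K h g \<and> bounded (h ` unit_disc) \<and>
     (\<forall>z\<in>unit_disc. (\<lambda>n. a n * z ^ n) sums h z) \<and>
     (\<forall>z\<in>unit_disc. (\<lambda>n. b (Suc n) * z ^ Suc n) sums g z)"

definition disc_sup_norm :: "(complex \<Rightarrow> complex) \<Rightarrow> real" where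
  "disc_sup_norm h = (SUP z\<in>unit_disc. norm (h z))"

text \<open>The terms of the majorant series, whose index runs from 1.\<close>

definition majorant_term ::
    "(nat \<Rightarrow> complex) \<Rightarrow> (nat \<Rightarrow> complex) \<Rightarrow> real \<Rightarrow> nat \<Rightarrow> real" where
  "majorant_term a b r n = (norm (a (Suc n)) + norm (b (Suc n))) * r ^ Suc n"

end

(* Normalise the sup norm of h to 1 and put t = |h 0|. Then |a_n| <= 1 - t^2 for n >= 1, and, since
   g' = w h' with |w| <= k, Bohr's inequality for w bounds the majorant series of g by k times that
   of h for r <= 1/3; both radii are at most 1/3. Together with the Schwarz-Pick bound
   |h z| <= (t + r) / (1 + t r) this reduces both inequalities to elementary ones whose worst case is
   t -> 1. Sharpness comes from h z = (a - z) / (1 - a z) and g = k (h - a) at z = -r as a -> 1: then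
   h + cnj g is an injective real-linear map composed with a disc automorphism. *)

theory Submission
  imports Defs "HOL-Complex_Analysis.Complex_Analysis"
begin

section \<open>Coefficients of bounded holomorphic functions\<close>

text \<open>The bound |g'| <= k |h'| does not compare b_n with a_n one index at a time; it only
  compares whole majorant series, and for that the Bohr radius 1/3 must not be exceeded. Since k + 1
  >= 1, both roots stay below it. The two equations are first-order conditions at t = 1. With s = k
  + 1 the majorant series costs at most s (1 - t^2) r / (1 - r), while Schwarz-Pick leaves the room
  1 - (t + r) / (1 + t r) = (1 - t) (1 - r) / (1 + t r). Cancelling 1 - t and putting t = 1 gives 2
  s r (1 + r) <= (1 - r)^2. For |h|^2 the room doubles to first order in 1 - t, so the factor 2
  disappears. Nothing is lost at that order: the disc automorphism attains Schwarz-Pick at z = -r,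
  and its coefficients have modulus (1 - a^2) a^(n-1), which is asymptotic to the bound 1 - a^2 as a
  -> 1. Quasiconformality includes a Sobolev condition, which has to be verified for the extremal
  maps; hence the integration by parts for C^1 maps.\<close>

lemma powser_sums_imp_has_fps_expansion:
  fixes f :: "complex \<Rightarrow> complex"
  assumes "\<And>z. norm z < 1 \<Longrightarrow> (\<lambda>n. a n * z ^ n) sums f z"
  shows "f has_fps_expansion Abs_fps a"
proof -
  have "conv_radius a \<ge> 1"
  proof (rule conv_radius_geI_ex)
    fix r :: real assume r: "0 < r" "ereal r < 1"
    then have "norm (of_real r :: complex) < 1" by simp
    then have "summable (\<lambda>n. a n * of_real r ^ n)"
      using assms sums_summable by blast
    then show "\<exists>z. norm z = r \<and> summable (\<lambda>n. a n * z ^ n)"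
      using r by (intro exI[of _ "of_real r"]) auto
  qed
  moreover have "fps_nth (Abs_fps a) = a" by (simp add: fun_eq_iff)
  ultimately have "fps_conv_radius (Abs_fps a) \<ge> 1"
    by (simp add: fps_conv_radius_def)
  then have "fps_conv_radius (Abs_fps a) > 0"
    by (rule less_le_trans[rotated]) simp
  moreover have "eventually (\<lambda>z. eval_fps (Abs_fps a) z = f z) (nhds 0)"
  proof -
    have "eventually (\<lambda>z::complex. z \<in> ball 0 1) (nhds 0)"
      by (rule eventually_nhds_in_open) auto
    then show ?thesis
      by eventually_elim (use assms in \<open>auto simp: eval_fps_def sums_iff\<close>)
  qed
  ultimately show ?thesis unfolding has_fps_expansion_def by blast
qed

lemma holomorphic_sums_fps_expansion:
  assumes "f holomorphic_on unit_disc" "norm z < 1"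
  shows "(\<lambda>n. fps_nth (fps_expansion f 0) n * z ^ n) sums f z"
  using holomorphic_power_series[OF assms(1), of z] assms(2) by (simp add: fps_expansion_def)

text \<open>Cauchy's estimate on circles of radius r < 1, followed by r -> 1, because
  \<open>f\<close> need not extend continuously to the closed disc.\<close>

lemma norm_fps_expansion_le:
  assumes holf: "f holomorphic_on unit_disc" and le: "\<And>z. norm z < 1 \<Longrightarrow> norm (f z) \<le> B"
  shows "norm (fps_nth (fps_expansion f 0) n) \<le> B"
proof -
  define c where "c = norm (fps_nth (fps_expansion f 0) n)"
  have "c * r ^ n \<le> B" if r: "0 < r" "r < 1" for r
  proof -
    have sub: "cball 0 r \<subseteq> unit_disc" "ball 0 r \<subseteq> unit_disc"
      using r by auto
    have "norm ((deriv ^^ n) f 0) \<le> fact n * B / r ^ n"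
    proof (rule Cauchy_inequality)
      show "f holomorphic_on ball 0 r" using holf sub(2) by (rule holomorphic_on_subset)
      show "continuous_on (cball 0 r) f"
        using holf sub(1) holomorphic_on_imp_continuous_on holomorphic_on_subset by blast
    qed (use r le in auto)
    then show ?thesis
      using r by (simp add: c_def fps_expansion_def norm_divide field_simps)
  qed
  then have "eventually (\<lambda>r. c * r ^ n \<le> B) (at_left 1)"
    by (auto simp: eventually_at_left_field intro!: exI[of _ 0])
  moreover have "((\<lambda>r. c * r ^ n) \<longlongrightarrow> c * 1 ^ n) (at_left 1)"
    by (intro tendsto_intros)
  ultimately have "c * 1 ^ n \<le> B"
    using tendsto_upperbound trivial_limit_at_left_real by blast
  then show ?thesis by (simp add: c_def)
qed

text \<open>The sum is geometric with ratio an n-th root of unity, and this ratio differs from 1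
  exactly because n does not divide m.\<close>

lemma sum_power_primitive_root:
  fixes n m :: nat
  assumes "n > 0" "\<not> n dvd m"
  shows "(\<Sum>j<n. (cis (2 * pi / n) ^ j) ^ m) = 0"
proof -
  define w where "w = cis (2 * pi / n) ^ m"
  have w: "w = exp (2 * of_real pi * \<i> * of_nat m / of_nat n)"
    by (simp add: w_def cis_conv_exp mult_ac flip: exp_of_nat_mult)
  then have "w \<noteq> 1" using complex_root_unity_eq_1[of n m] assms by simp
  moreover have "w ^ n = 1"
  proof -
    have "cis (2 * pi / n) ^ n = 1" using assms(1) by (simp add: Complex.DeMoivre)
    then show ?thesis by (metis w_def power_mult mult.commute power_one)
  qed
  ultimately have "(\<Sum>j<n. w ^ j) = 0" by (simp add: geometric_sum)
  then show ?thesis by (simp add: w_def mult.commute flip: power_mult)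
qed

text \<open>Averaging over the \<open>n\<close>-th roots of unity kills the coefficients with index strictly between
  \<open>0\<close> and \<open>n\<close>, so that composing with a disc automorphism only rescales the \<open>n\<close>-th one.\<close>

lemma norm_coeff_le_one_minus_sq:
  assumes holf: "f holomorphic_on unit_disc" and less: "\<And>z. norm z < 1 \<Longrightarrow> norm (f z) < 1"
    and exp: "f has_fps_expansion F" and n: "n > 0"
  shows "norm (fps_nth F n) \<le> 1 - (norm (f 0))\<^sup>2"
proof -
  define \<zeta> where "\<zeta> = cis (2 * pi / n)"
  define av where "av = (\<lambda>z. (\<Sum>j<n. f (\<zeta> ^ j * z)) / of_nat n)"
  define c where "c = f 0"
  have \<zeta>: "norm (\<zeta> ^ j * z) = norm z" for j z
    by (simp add: \<zeta>_def norm_mult norm_power)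
  have F: "fps_expansion f 0 = F" using exp by (rule fps_expansion_eqI)
  have F0: "fps_nth F 0 = c" using holomorphic_sums_fps_expansion[OF holf, of 0] exp
    by (simp add: c_def has_fps_expansion_imp_0_eq_fps_nth_0)
  have c1: "norm c < 1" using less[of 0] by (simp add: c_def)
  have av_less: "norm (av z) < 1" if "norm z < 1" for z
  proof -
    have "norm (\<Sum>j<n. f (\<zeta> ^ j * z)) \<le> (\<Sum>j<n. norm (f (\<zeta> ^ j * z)))" by (rule norm_sum)
    also have "\<dots> < (\<Sum>j<n. 1)" using n less that \<zeta> by (intro sum_strict_mono) (auto simp: lessThan_empty_iff)
    finally show ?thesis using n by (simp add: av_def norm_divide)
  qed
  have av_hol: "av holomorphic_on unit_disc"
    unfolding av_def
    by (intro holomorphic_intros holomorphic_on_compose_gen[OF _ holf, unfolded o_def])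
       (use n \<zeta> in auto)
  define A where "A = Abs_fps (\<lambda>m. fps_nth F m * (\<Sum>j<n. (\<zeta> ^ j) ^ m) / of_nat n)"
  have avA: "av has_fps_expansion A"
    unfolding A_def
  proof (rule powser_sums_imp_has_fps_expansion)
    fix z :: complex assume z: "norm z < 1"
    have "(\<lambda>m. (\<Sum>j<n. fps_nth F m * (\<zeta> ^ j * z) ^ m) / of_nat n) sums av z"
      unfolding av_def using holomorphic_sums_fps_expansion[OF holf] z \<zeta> F
      by (intro sums_divide sums_sum) auto
    then show "(\<lambda>m. fps_nth F m * (\<Sum>j<n. (\<zeta> ^ j) ^ m) / of_nat n * z ^ m) sums av z"
      by (simp add: power_mult_distrib sum_distrib_left sum_distrib_right mult_ac)
  qed
  have A0: "fps_nth A 0 = c" using n F0 by (simp add: A_def)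
  have Am: "fps_nth A m = 0" if "0 < m" "m < n" for m
  proof -
    have "\<not> n dvd m" using that by (auto dest: dvd_imp_le)
    then show ?thesis using sum_power_primitive_root[of n m] that by (simp add: A_def \<zeta>_def)
  qed
  have An: "fps_nth A n = fps_nth F n"
  proof -
    have "(\<zeta> ^ j) ^ n = 1" for j
    proof -
      have "\<zeta> ^ n = 1" using n by (simp add: \<zeta>_def Complex.DeMoivre)
      then show ?thesis by (metis power_mult mult.commute power_one)
    qed
    then show ?thesis using n by (simp add: A_def)
  qed
  \<comment> \<open>The automorphism sends the constant term \<open>c\<close> of \<open>av\<close>
    to 0, so \<open>\<psi>\<close> is again a self-map of the disc, now vanishing at the
    origin.\<close>
  define \<psi> where "\<psi> = Moebius_function 0 c \<circ> av"
  have \<psi>_hol: "\<psi> holomorphic_on unit_disc"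
    unfolding \<psi>_def using av_less
    by (intro holomorphic_on_compose_gen[OF av_hol Moebius_function_holomorphic[OF c1]]) auto
  have \<psi>_less: "norm (\<psi> z) < 1" if "norm z < 1" for z
    unfolding \<psi>_def o_def by (rule Moebius_function_norm_lt_1[OF c1 av_less[OF that]])
  define P where "P = fps_expansion \<psi> 0"
  have \<psi>P: "\<psi> has_fps_expansion P"
    unfolding P_def using \<psi>_hol by (intro has_fps_expansion_fps_expansion[of unit_disc]) auto
  \<comment> \<open>The equation defining \<open>\<psi>\<close> with its denominator cleared:
    coefficients can then be read off from a convolution, without inverting a power series.\<close>
  have "P * (1 - fps_const (cnj c) * A) = A - fps_const c"
  proof (rule fps_expansion_unique_complex)
    show "(\<lambda>z. \<psi> z * (1 - cnj c * av z)) has_fps_expansion P * (1 - fps_const (cnj c) * A)"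
      by (intro fps_expansion_intros \<psi>P avA)
    have "(\<lambda>z. av z - c) has_fps_expansion A - fps_const c"
      by (intro fps_expansion_intros avA)
    moreover have "eventually (\<lambda>z. av z - c = \<psi> z * (1 - cnj c * av z)) (nhds 0)"
    proof -
      have "eventually (\<lambda>z::complex. z \<in> ball 0 1) (nhds 0)"
        by (rule eventually_nhds_in_open) auto
      then show ?thesis
      proof eventually_elim
        case (elim z)
        have "norm (cnj c * av z) < 1" using c1 av_less[of z] elim norm_mult_less[of "cnj c" 1 "av z" 1] by simp
        then have "1 - cnj c * av z \<noteq> 0" by force
        then show ?case by (simp add: \<psi>_def Moebius_function_simple)
      qed
    qed
    ultimately show "(\<lambda>z. \<psi> z * (1 - cnj c * av z)) has_fps_expansion A - fps_const c"
      using has_fps_expansion_cong by fastforce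
  qed
  then have eq: "P = A - fps_const c + fps_const (cnj c) * (P * A)"
    by (simp add: algebra_simps)
  have rec: "fps_nth P m = fps_nth (A - fps_const c) m + cnj c * (\<Sum>i=0..m. fps_nth P i * fps_nth A (m - i))" for m
    using arg_cong[OF eq, of "\<lambda>G. fps_nth G m"]
    unfolding fps_add_nth fps_mult_left_const_nth fps_mult_nth[of P A] .
  have c2: "1 - cnj c * c \<noteq> 0"
  proof -
    have "norm (cnj c * c) < 1" using c1 norm_mult_less[of "cnj c" 1 c 1] by simp
    then show ?thesis by force
  qed
  \<comment> \<open>By induction the convolution in degree m reduces to its last term
    \<open>fps_nth P m * c\<close>, and \<open>A - fps_const c\<close> has no terms below degree n.
    So \<open>fps_nth P m\<close> is killed by the nonzero factor 1 - |c|^2.\<close>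
  have P0: "fps_nth P m = 0" if "m < n" for m
    using that
  proof (induction m rule: less_induct)
    case (less m)
    have "(\<Sum>i=0..m. fps_nth P i * fps_nth A (m - i)) = fps_nth P m * c"
      using less by (subst sum.remove[of _ m]) (auto simp: A0)
    moreover have "fps_nth (A - fps_const c) m = 0" using less Am[of m] A0 by (cases m) auto
    ultimately have "fps_nth P m * (1 - cnj c * c) = 0" using rec[of m] by (simp add: algebra_simps)
    then show ?case using c2 by simp
  qed
  \<comment> \<open>The same collapse in degree n leaves F_n = (1 - |c|^2) P_n, and |P_n| <= 1 by
    Cauchy's estimate for \<open>\<psi>\<close>.\<close>
  have "(\<Sum>i=0..n. fps_nth P i * fps_nth A (n - i)) = fps_nth P n * c"
    using P0 by (subst sum.remove[of _ n]) (auto simp: A0)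
  with rec[of n] have "fps_nth P n = fps_nth F n + cnj c * (fps_nth P n * c)"
    using An n by simp
  then have "fps_nth P n * (1 - cnj c * c) = fps_nth F n"
    by (simp add: algebra_simps)
  then have "norm (fps_nth F n) = norm (fps_nth P n) * norm (1 - cnj c * c)"
    by (metis norm_mult)
  also have "1 - cnj c * c = of_real (1 - (norm c)\<^sup>2)"
    by (metis complex_norm_square mult.commute of_real_1 of_real_diff)
  also have "norm (of_real (1 - (norm c)\<^sup>2) :: complex) = 1 - (norm c)\<^sup>2"
    unfolding norm_of_real using c1 by (simp add: abs_square_le_1 less_imp_le)
  also have "norm (fps_nth P n) * (1 - (norm c)\<^sup>2) \<le> 1 * (1 - (norm c)\<^sup>2)"
    using norm_fps_expansion_le[OF \<psi>_hol, of 1 n] \<psi>_less c1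
    by (intro mult_right_mono) (auto simp: P_def less_imp_le abs_square_le_1)
  finally show ?thesis by (simp add: c_def)
qed

section \<open>Schwarz--Pick and Bohr inequalities\<close>

lemma norm_coeff_le:
  assumes holf: "f holomorphic_on unit_disc" and less: "\<And>z. norm z < 1 \<Longrightarrow> norm (f z) < M"
    and exp: "f has_fps_expansion F" and n: "n > 0"
  shows "norm (fps_nth F n) \<le> M * (1 - (norm (f 0) / M)\<^sup>2)"
proof -
  have M: "M > 0" using le_less_trans[OF norm_ge_zero less[of 0]] by simp
  define c where "c = inverse (of_real M :: complex)"
  have c: "norm c = inverse M" using M by (simp add: c_def norm_inverse)
  have "norm (fps_nth (fps_const c * F) n) \<le> 1 - (norm (c * f 0))\<^sup>2"
  proof (rule norm_coeff_le_one_minus_sq[OF _ _ _ n])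
    show "(\<lambda>z. c * f z) holomorphic_on unit_disc" by (intro holomorphic_intros holf)
    show "(\<lambda>z. c * f z) has_fps_expansion fps_const c * F" by (intro fps_expansion_intros exp)
    show "norm (c * f z) < 1" if "norm z < 1" for z
      using less[OF that] M by (simp add: norm_mult c divide_inverse[symmetric] mult.commute[of "inverse M"])
  qed
  then have "norm (fps_nth F n) / M \<le> 1 - (norm (f 0) / M)\<^sup>2"
    by (simp add: norm_mult c divide_inverse mult.commute)
  then show ?thesis using M by (simp only: pos_divide_le_eq mult.commute)
qed

text \<open>Schwarz's lemma bounds |w - c| / |1 - cnj c w| by |z|. Passing from c and w to their
  moduli can only shrink this pseudo-hyperbolic distance, so |w| - |c| <= |z| (1 - |c| |w|), which
  is solved for |w|.\<close>

lemma Schwarz_Pick_bound: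
  assumes holf: "f holomorphic_on unit_disc" and less: "\<And>z. norm z < 1 \<Longrightarrow> norm (f z) < 1"
    and z: "norm z < 1"
  shows "norm (f z) \<le> (norm (f 0) + norm z) / (1 + norm (f 0) * norm z)"
proof -
  define c w where "c = f 0" and "w = f z"
  have c1: "norm c < 1" and w1: "norm w < 1" using less[of 0] less[OF z] by (auto simp: c_def w_def)
  define m where "m = Moebius_function 0 c w"
  have "norm ((Moebius_function 0 c \<circ> f) z) \<le> norm z"
  proof (rule Schwarz_Lemma(1)[OF _ _ _ z])
    show "Moebius_function 0 c \<circ> f holomorphic_on unit_disc" using less
      by (intro holomorphic_on_compose_gen[OF holf Moebius_function_holomorphic[OF c1]]) auto
  qed (auto simp: c_def Moebius_function_eq_zero intro!: Moebius_function_norm_lt_1 less)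
  then have m: "norm m \<le> norm z" by (simp add: m_def w_def)
  have "norm (cnj c * w) < 1" using c1 w1 norm_mult_less[of "cnj c" 1 w 1] by simp
  then have nz: "1 - cnj c * w \<noteq> 0" by force
  have cw: "0 < 1 - norm c * norm w"
    using \<open>norm (cnj c * w) < 1\<close> by (simp add: norm_mult)
  \<comment> \<open>This identity expresses the distance through a product depending on moduli only,
    divided by |1 - cnj c w|^2. Used once for c, w and once for |c|, |w|, it compares the two
    distances.\<close>
  have eq: "(norm (1 - cnj c * w))\<^sup>2 - (norm (w - c))\<^sup>2 = (1 - (norm c)\<^sup>2) * (1 - (norm w)\<^sup>2)"
    by (cases c; cases w) (simp add: cmod_power2; simp add: power2_eq_square algebra_simps)
  have "norm (w - c) = norm m * norm (1 - cnj c * w)"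
    using nz by (simp add: m_def Moebius_function_simple norm_divide)
  also have "\<dots> \<le> norm z * norm (1 - cnj c * w)" using m by (rule mult_right_mono) simp
  finally have "(norm (w - c))\<^sup>2 \<le> (norm z)\<^sup>2 * (norm (1 - cnj c * w))\<^sup>2"
    by (metis norm_ge_zero power_mono power_mult_distrib)
  then have "(1 - (norm z)\<^sup>2) * (norm (1 - cnj c * w))\<^sup>2 \<le> (1 - (norm c)\<^sup>2) * (1 - (norm w)\<^sup>2)"
    using eq by (simp add: algebra_simps)
  moreover have "(1 - norm c * norm w)\<^sup>2 \<le> (norm (1 - cnj c * w))\<^sup>2"
  proof (rule power_mono)
    show "1 - norm c * norm w \<le> norm (1 - cnj c * w)"
      using norm_triangle_ineq2[of 1 "cnj c * w"] by (simp add: norm_mult)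
  qed (use cw in simp)
  moreover have "0 \<le> 1 - (norm z)\<^sup>2" using z by (simp add: abs_square_le_1)
  ultimately have "(1 - (norm z)\<^sup>2) * (1 - norm c * norm w)\<^sup>2 \<le> (1 - (norm c)\<^sup>2) * (1 - (norm w)\<^sup>2)"
    by (meson mult_left_mono order_trans)
  also have "\<dots> = (1 - norm c * norm w)\<^sup>2 - (norm w - norm c)\<^sup>2"
    by (simp add: power2_eq_square algebra_simps)
  finally have "(norm w - norm c)\<^sup>2 \<le> (norm z * (1 - norm c * norm w))\<^sup>2"
    unfolding power_mult_distrib by (simp add: algebra_simps)
  then have "norm w - norm c \<le> norm z * (1 - norm c * norm w)"
    by (rule power2_le_imp_le) (use cw in simp)
  then have "norm w * (1 + norm c * norm z) \<le> norm c + norm z" by (simp add: algebra_simps)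
  moreover have "0 < 1 + norm c * norm z" by (simp add: add_pos_nonneg)
  ultimately show ?thesis by (simp add: c_def w_def pos_le_divide_eq)
qed

lemma Schwarz_Pick_bound_scaled:
  assumes holf: "f holomorphic_on unit_disc" and less: "\<And>z. norm z < 1 \<Longrightarrow> norm (f z) < M"
    and z: "norm z < 1"
  shows "norm (f z) \<le> M * ((norm (f 0) / M + norm z) / (1 + norm (f 0) / M * norm z))"
proof -
  have M: "M > 0" using le_less_trans[OF norm_ge_zero less[of 0]] by simp
  define f1 where "f1 = (\<lambda>z. f z / of_real M)"
  have n: "norm (f1 z) = norm (f z) / M" for z using M by (simp add: f1_def norm_divide)
  have "norm (f1 z) \<le> (norm (f1 0) + norm z) / (1 + norm (f1 0) * norm z)"
  proof (rule Schwarz_Pick_bound)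
    show "f1 holomorphic_on unit_disc" unfolding f1_def by (intro holomorphic_intros holf) (use M in auto)
  qed (use M less n z in auto)
  then show ?thesis using M unfolding n by (simp add: pos_divide_le_eq mult.commute)
qed

section \<open>Bohr's inequality and the majorant series of g\<close>

lemma geometric_majorant:
  fixes u :: "nat \<Rightarrow> real"
  assumes "\<And>n. 0 \<le> u n" "\<And>n. u n \<le> B" "0 \<le> r" "r < 1"
  shows "summable (\<lambda>n. u n * r ^ Suc n)" "(\<Sum>n. u n * r ^ Suc n) \<le> B * (r / (1 - r))"
proof -
  have "(\<lambda>n. r ^ n) sums (1 / (1 - r))" using assms by (intro geometric_sums) simp
  then have g: "(\<lambda>n. (B * r) * r ^ n) sums (B * r * (1 / (1 - r)))" by (rule sums_mult)
  have le: "u n * r ^ Suc n \<le> (B * r) * r ^ n" for n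
    using mult_right_mono[OF assms(2), of "r ^ Suc n" n] assms by (simp add: mult_ac)
  show s: "summable (\<lambda>n. u n * r ^ Suc n)"
    by (rule summable_comparison_test'[OF sums_summable[OF g], of 0])
       (use le assms in \<open>simp add: abs_mult\<close>)
  show "(\<Sum>n. u n * r ^ Suc n) \<le> B * (r / (1 - r))"
    using suminf_le[OF le s sums_summable[OF g]] sums_unique[OF g] by simp
qed

text \<open>The bound on f is not strict, because the dilatation to which this is applied may be a
  constant of modulus M, as it is for the extremal maps. The coefficient estimate wants a strict
  bound, so the argument runs with every N > M and then lets N decrease to M.\<close>

lemma Bohr_inequality:
  assumes hol: "f holomorphic_on unit_disc" and le: "\<And>z. norm z < 1 \<Longrightarrow> norm (f z) \<le> M"
    and exp: "f has_fps_expansion F" and r: "0 \<le> r" "r \<le> 1 / 3"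
  shows "summable (\<lambda>n. norm (fps_nth F n) * r ^ n)" "(\<Sum>n. norm (fps_nth F n) * r ^ n) \<le> M"
proof -
  have *: "summable (\<lambda>n. norm (fps_nth F n) * r ^ n) \<and> (\<Sum>n. norm (fps_nth F n) * r ^ n) \<le> N"
    if N: "M < N" for N
  proof -
    define t where "t = norm (f 0) / N"
    have less: "norm (f z) < N" if "norm z < 1" for z using le[OF that] N by simp
    have N0: "N > 0" using le_less_trans[OF norm_ge_zero less[of 0]] by simp
    have t: "0 \<le> t" "t < 1" using less[of 0] N0 by (auto simp: t_def)
    have "norm (fps_nth F (Suc n)) \<le> N * (1 - t\<^sup>2)" for n
      unfolding t_def by (rule norm_coeff_le[OF hol less exp]) auto
    note gm = geometric_majorant[of "\<lambda>n. norm (fps_nth F (Suc n))", OF _ this r(1)]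
    have r1: "r < 1" using r by simp
    have s: "summable (\<lambda>n. norm (fps_nth F n) * r ^ n)"
      using gm(1) r1 by (subst summable_Suc_iff[symmetric]) simp
    have "(\<Sum>n. norm (fps_nth F n) * r ^ n) = norm (fps_nth F 0) + (\<Sum>n. norm (fps_nth F (Suc n)) * r ^ Suc n)"
      using suminf_split_head[OF s] by simp
    also have "fps_nth F 0 = f 0" using exp by (simp add: has_fps_expansion_imp_0_eq_fps_nth_0)
    also have "norm (f 0) = N * t" using N0 by (simp add: t_def)
    also have "(\<Sum>n. norm (fps_nth F (Suc n)) * r ^ Suc n) \<le> N * (1 - t\<^sup>2) * (r / (1 - r))"
      using gm(2) r1 by simp
    \<comment> \<open>Here 1/3 enters, as r / (1 - r) <= 1/2. The value 1/2 is the largest q with t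
      + q (1 - t^2) <= 1 for all t in [0,1).\<close>
    also have "\<dots> \<le> N * (1 - t\<^sup>2) * (1 / 2)"
      using r N0 t by (intro mult_left_mono) (auto simp: field_simps abs_square_le_1)
    also have "N * t + N * (1 - t\<^sup>2) * (1 / 2) = N * (1 - (1 - t)\<^sup>2 / 2)"
      by (simp add: power2_eq_square field_simps)
    also have "\<dots> \<le> N" using N0 by (simp add: mult_le_cancel_left1)
    finally show ?thesis using s by simp
  qed
  show "summable (\<lambda>n. norm (fps_nth F n) * r ^ n)" using *[of "M + 1"] by simp
  show "(\<Sum>n. norm (fps_nth F n) * r ^ n) \<le> M" 
  proof (rule dense_ge)
    fix N assume "M < N"
    then show "(\<Sum>n. norm (fps_nth F n) * r ^ n) \<le> N" using * by simp
  qed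
qed

text \<open>Comparing coefficients in \<open>g' = \<omega> h'\<close> gives \<open>n |b\<^sub>n| \<le> \<Sum>\<^sub>i |c\<^sub>i| (n - i) |a\<^sub>n\<^sub>-\<^sub>i|\<close> with
  \<open>c\<^sub>i\<close> the coefficients of the dilatation \<open>\<omega>\<close>. After dividing by \<open>n\<close> the right-hand side is
  dominated by a Cauchy product, and Bohr's inequality applies to \<open>\<omega>\<close>.\<close>

lemma majorant_dominated_derivative:
  assumes holh: "h holomorphic_on unit_disc" and holg: "g holomorphic_on unit_disc"
    and nz: "\<And>z. norm z < 1 \<Longrightarrow> deriv h z \<noteq> 0"
    and dom: "\<And>z. norm z < 1 \<Longrightarrow> norm (deriv g z) \<le> k * norm (deriv h z)"
    and exph: "h has_fps_expansion A" and expg: "g has_fps_expansion B"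
    and r: "0 \<le> r" "r \<le> 1 / 3"
    and sumA: "summable (\<lambda>n. norm (fps_nth A (Suc n)) * r ^ Suc n)"
  shows "summable (\<lambda>n. norm (fps_nth B (Suc n)) * r ^ Suc n)"
    "(\<Sum>n. norm (fps_nth B (Suc n)) * r ^ Suc n) \<le> k * (\<Sum>n. norm (fps_nth A (Suc n)) * r ^ Suc n)"
proof -
  define \<omega> where "\<omega> = (\<lambda>z. deriv g z / deriv h z)"
  have hol: "\<omega> holomorphic_on unit_disc"
    unfolding \<omega>_def using nz
    by (intro holomorphic_intros holomorphic_deriv holh holg) auto
  have le: "norm (\<omega> z) \<le> k" if "norm z < 1" for z
    using dom[OF that] nz[OF that] by (simp add: \<omega>_def norm_divide field_simps)
  define C where "C = fps_expansion \<omega> 0"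
  have expC: "\<omega> has_fps_expansion C"
    unfolding C_def using hol by (intro has_fps_expansion_fps_expansion[of unit_disc]) auto
  note Bohr = Bohr_inequality[OF hol le expC r]
  have eq: "fps_deriv B = C * fps_deriv A"
  proof (rule fps_expansion_unique_complex)
    show "deriv g has_fps_expansion fps_deriv B" using expg by (rule has_fps_expansion_deriv)
    have "(\<lambda>z. \<omega> z * deriv h z) has_fps_expansion C * fps_deriv A"
      by (intro has_fps_expansion_mult expC has_fps_expansion_deriv exph)
    moreover have "eventually (\<lambda>z. \<omega> z * deriv h z = deriv g z) (nhds 0)"
    proof -
      have "eventually (\<lambda>z::complex. z \<in> ball 0 1) (nhds 0)"
        by (rule eventually_nhds_in_open) auto
      then show ?thesis by eventually_elim (use nz in \<open>simp add: \<omega>_def\<close>)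
    qed
    ultimately show "deriv g has_fps_expansion C * fps_deriv A"
      using has_fps_expansion_cong by fastforce
  qed
  define c where "c = (\<lambda>i. norm (fps_nth C i) * r ^ i)"
  define a where "a = (\<lambda>i. norm (fps_nth A (Suc i)) * r ^ Suc i)"
  have c0: "c i \<ge> 0" and a0: "a i \<ge> 0" for i using r by (auto simp: c_def a_def)
  have sc: "summable (\<lambda>i. norm (c i))" and sa: "summable (\<lambda>i. norm (a i))"
    using Bohr(1) sumA c0 a0 unfolding c_def a_def by simp_all
  \<comment> \<open>\<open>a\<close> starts with the linear coefficient of \<open>A\<close>, so the
    n-th term of the product controls the coefficient of \<open>B\<close> with index
    \<open>Suc n\<close>.\<close>
  define p where "p = (\<lambda>n. \<Sum>i\<le>n. c i * a (n - i))"
  have p: "p sums ((\<Sum>i. c i) * (\<Sum>i. a i))"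
    unfolding p_def by (rule Cauchy_product_sums[OF sc sa])
  have bound: "norm (fps_nth B (Suc n)) * r ^ Suc n \<le> p n" for n
  proof -
    have "real (Suc n) * norm (fps_nth B (Suc n)) = norm (fps_nth (fps_deriv B) n)"
      by (simp add: norm_mult del: of_nat_Suc)
    also have "fps_nth (fps_deriv B) n = (\<Sum>i=0..n. fps_nth C i * fps_nth (fps_deriv A) (n - i))"
      unfolding eq by (rule fps_mult_nth)
    also have "norm \<dots> \<le> (\<Sum>i=0..n. norm (fps_nth C i) * (real (Suc (n - i)) * norm (fps_nth A (Suc (n - i)))))"
      by (rule sum_norm_le) (simp add: norm_mult del: of_nat_Suc)
    \<comment> \<open>Differentiation produced the weights \<open>Suc (n - i)\<close>. Enlarging
      them to \<open>Suc n\<close> makes them independent of i, and they cancel against the same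
      factor on the left.\<close>
    also have "\<dots> \<le> (\<Sum>i=0..n. norm (fps_nth C i) * (real (Suc n) * norm (fps_nth A (Suc (n - i)))))"
      by (intro sum_mono mult_left_mono mult_right_mono) auto
    also have "\<dots> = real (Suc n) * (\<Sum>i=0..n. norm (fps_nth C i) * norm (fps_nth A (Suc (n - i))))"
      by (simp add: sum_distrib_left mult_ac)
    finally have "norm (fps_nth B (Suc n)) \<le> (\<Sum>i=0..n. norm (fps_nth C i) * norm (fps_nth A (Suc (n - i))))"
      by (rule mult_left_le_imp_le) simp
    then have "norm (fps_nth B (Suc n)) * r ^ Suc n \<le> (\<Sum>i=0..n. norm (fps_nth C i) * norm (fps_nth A (Suc (n - i)))) * r ^ Suc n"
      using r by (intro mult_right_mono) auto
    also have "\<dots> = (\<Sum>i=0..n. (norm (fps_nth C i) * norm (fps_nth A (Suc (n - i)))) * (r ^ i * r ^ Suc (n - i)))"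
      unfolding sum_distrib_right
    proof (rule sum.cong[OF refl])
      fix i assume "i \<in> {0..n}"
      then have "r ^ Suc n = r ^ i * r ^ Suc (n - i)" by (simp flip: power_add power_Suc add: Suc_diff_le)
      then show "norm (fps_nth C i) * norm (fps_nth A (Suc (n - i))) * r ^ Suc n =
        norm (fps_nth C i) * norm (fps_nth A (Suc (n - i))) * (r ^ i * r ^ Suc (n - i))" by simp
    qed
    also have "\<dots> = p n"
      by (simp add: p_def c_def a_def atLeast0AtMost mult_ac)
    finally show ?thesis .
  qed
  show s: "summable (\<lambda>n. norm (fps_nth B (Suc n)) * r ^ Suc n)"
    by (rule summable_comparison_test'[OF sums_summable[OF p], of 0])
       (use bound r in \<open>simp add: abs_mult\<close>)
  have "(\<Sum>n. norm (fps_nth B (Suc n)) * r ^ Suc n) \<le> (\<Sum>n. p n)"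
    by (rule suminf_le[OF bound s sums_summable[OF p]])
  also have "\<dots> = (\<Sum>i. c i) * (\<Sum>i. a i)" using p by (simp add: sums_iff)
  also have "\<dots> \<le> k * (\<Sum>i. a i)"
    using Bohr(2) sa a0 unfolding c_def by (intro mult_right_mono suminf_nonneg) auto
  finally show "(\<Sum>n. norm (fps_nth B (Suc n)) * r ^ Suc n) \<le> k * (\<Sum>n. norm (fps_nth A (Suc n)) * r ^ Suc n)"
    by (simp add: a_def)
qed

text \<open>The sequence \<open>b\<close> is arbitrary at 0, whereas a full power series for g needs
  constant term 0.\<close>

lemma powser_sums_shift:
  fixes b :: "nat \<Rightarrow> complex"
  assumes "(\<lambda>n. b (Suc n) * z ^ Suc n) sums s"
  shows "(\<lambda>n. (if n = 0 then 0 else b n) * z ^ n) sums s"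
proof -
  define u where "u = (\<lambda>n. (if n = 0 then 0 else b n) * z ^ n)"
  have "(\<lambda>n. u (Suc n)) sums s" using assms by (simp add: u_def)
  then have "u sums (s + u 0)" by (rule sums_Suc)
  then show ?thesis by (simp add: u_def)
qed

lemma majorant_bound:
  assumes holh: "h holomorphic_on unit_disc" and holg: "g holomorphic_on unit_disc"
    and nz: "\<And>z. norm z < 1 \<Longrightarrow> deriv h z \<noteq> 0"
    and dom: "\<And>z. norm z < 1 \<Longrightarrow> norm (deriv g z) \<le> k * norm (deriv h z)"
    and less: "\<And>z. norm z < 1 \<Longrightarrow> norm (h z) < M"
    and sumsh: "\<And>z. norm z < 1 \<Longrightarrow> (\<lambda>n. a n * z ^ n) sums h z"
    and sumsg: "\<And>z. norm z < 1 \<Longrightarrow> (\<lambda>n. b (Suc n) * z ^ Suc n) sums g z"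
    and r: "0 \<le> r" "r \<le> 1 / 3" and k: "k \<ge> 0"
  shows "summable (majorant_term a b r)"
    "(\<Sum>n. majorant_term a b r n) \<le> M * ((1 + k) * (1 - (norm (h 0) / M)\<^sup>2) * (r / (1 - r)))"
proof -
  define A B where "A = Abs_fps a" and "B = Abs_fps (\<lambda>n. if n = 0 then 0 else b n)"
  have exph: "h has_fps_expansion A" unfolding A_def by (rule powser_sums_imp_has_fps_expansion[OF sumsh])
  have expg: "g has_fps_expansion B" unfolding B_def
    by (rule powser_sums_imp_has_fps_expansion[OF powser_sums_shift[OF sumsg]])
  have "norm (fps_nth A (Suc n)) \<le> M * (1 - (norm (h 0) / M)\<^sup>2)" for n
    by (rule norm_coeff_le[OF holh less exph]) auto
  note gm = geometric_majorant[of "\<lambda>n. norm (fps_nth A (Suc n))", OF _ this r(1)]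
  have r1: "r < 1" using r by simp
  have sA: "summable (\<lambda>n. norm (fps_nth A (Suc n)) * r ^ Suc n)" using gm(1) r1 by simp
  note dd = majorant_dominated_derivative[OF holh holg nz dom exph expg r sA]
  have eq: "majorant_term a b r n =
      norm (fps_nth A (Suc n)) * r ^ Suc n + norm (fps_nth B (Suc n)) * r ^ Suc n" for n
    by (simp add: majorant_term_def A_def B_def algebra_simps)
  have eq': "majorant_term a b r =
      (\<lambda>n. norm (fps_nth A (Suc n)) * r ^ Suc n + norm (fps_nth B (Suc n)) * r ^ Suc n)"
    by (rule ext) (rule eq)
  show "summable (majorant_term a b r)" unfolding eq' by (rule summable_add[OF sA dd(1)])
  have "(\<Sum>n. majorant_term a b r n) =
      (\<Sum>n. norm (fps_nth A (Suc n)) * r ^ Suc n) + (\<Sum>n. norm (fps_nth B (Suc n)) * r ^ Suc n)"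
    unfolding eq' by (rule suminf_add[OF sA dd(1), symmetric])
  also have "\<dots> \<le> (1 + k) * (\<Sum>n. norm (fps_nth A (Suc n)) * r ^ Suc n)"
    using dd(2) by (simp add: algebra_simps)
  also have "\<dots> \<le> (1 + k) * (M * (1 - (norm (h 0) / M)\<^sup>2) * (r / (1 - r)))"
    using gm(2) r1 k by (intro mult_left_mono) auto
  finally show "(\<Sum>n. majorant_term a b r n) \<le> M * ((1 + k) * (1 - (norm (h 0) / M)\<^sup>2) * (r / (1 - r)))"
    by (simp add: mult_ac)
qed

section \<open>Weak derivatives and Sobolev regularity of harmonic maps\<close>

lemma integrable_lborel_compact_support:
  fixes u :: "'a::euclidean_space \<Rightarrow> 'b::{banach, second_countable_topology}"
  assumes "continuous_on UNIV u" "compact S" "\<And>z. z \<notin> S \<Longrightarrow> u z = 0"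
  shows "integrable lborel u"
proof -
  have "integrable lborel (\<lambda>z. indicator S z *\<^sub>R u z)"
    by (rule borel_integrable_compact[OF assms(2)]) (rule continuous_on_subset[OF assms(1)], simp)
  also have "(\<lambda>z. indicator S z *\<^sub>R u z) = u"
    using assms(3) by (auto simp: fun_eq_iff indicator_def)
  finally show ?thesis .
qed

lemma has_derivative_zero_outside_support:
  assumes "(\<psi> has_derivative L) (at z)" "closed S" "z \<notin> S" "\<And>x. x \<notin> S \<Longrightarrow> \<psi> x = 0"
  shows "L = (\<lambda>_. 0)"
proof -
  have "(\<psi> has_derivative (\<lambda>_. 0)) (at z)"
    by (rule has_derivative_transform_within_open[of "\<lambda>_. 0" _ _ _ "- S"]) (use assms in auto)
  then show ?thesis using assms(1) by (rule has_derivative_unique[symmetric])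
qed

text \<open>The difference quotients integrate to zero by translation invariance and are dominated by
  the Lipschitz constant.\<close>

lemma integral_derivative_compact_support:
  fixes \<psi> :: "'a::euclidean_space \<Rightarrow> 'b::{banach, second_countable_topology}"
  assumes der: "\<And>z. (\<psi> has_derivative \<Psi> z) (at z)"
    and cont: "continuous_on UNIV (\<lambda>z. \<Psi> z v)"
    and S: "compact S" "\<And>z. z \<notin> S \<Longrightarrow> \<psi> z = 0"
  shows "integral\<^sup>L lborel (\<lambda>z. \<Psi> z v) = 0"
proof -
  have cont\<psi>: "continuous_on UNIV \<psi>"
    using der by (intro has_derivative_continuous_on) auto
  then have [measurable]: "\<psi> \<in> borel_measurable borel" by (rule borel_measurable_continuous_onI)
  have [measurable]: "(\<lambda>z. \<Psi> z v) \<in> borel_measurable borel"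
    using cont by (rule borel_measurable_continuous_onI)
  have out: "\<Psi> z v = 0" if "z \<notin> S" for z
    using has_derivative_zero_outside_support[OF der compact_imp_closed[OF S(1)] that S(2)] by simp
  have "bounded ((\<lambda>z. \<Psi> z v) ` S)"
    using S(1) cont by (intro compact_imp_bounded compact_continuous_image) (auto intro: continuous_on_subset)
  then obtain C where C: "C > 0" "\<And>z. z \<in> S \<Longrightarrow> norm (\<Psi> z v) \<le> C"
    unfolding bounded_pos by auto
  have C': "norm (\<Psi> z v) \<le> C" for z using C out[of z] by (cases "z \<in> S") auto
  obtain R where R: "\<And>z. z \<in> S \<Longrightarrow> norm z \<le> R"
    using compact_imp_bounded[OF S(1)] unfolding bounded_iff by auto
  have Lip: "norm (\<psi> (z + t *\<^sub>R v) - \<psi> z) \<le> C * t" if "t \<ge> 0" for z t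
  proof -
    have "norm (\<psi> (z + t *\<^sub>R v) - \<psi> (z + 0 *\<^sub>R v)) \<le> C * norm (t - 0)"
    proof (rule differentiable_bound[of UNIV "\<lambda>s. \<psi> (z + s *\<^sub>R v)" "\<lambda>s h. \<Psi> (z + s *\<^sub>R v) (h *\<^sub>R v)"])
      fix s :: real
      show "((\<lambda>s. \<psi> (z + s *\<^sub>R v)) has_derivative (\<lambda>h. \<Psi> (z + s *\<^sub>R v) (h *\<^sub>R v))) (at s within UNIV)"
        by (rule has_derivative_compose[OF _ der]) (auto intro!: derivative_eq_intros)
      have "bounded_linear (\<Psi> (z + s *\<^sub>R v))" using der by (rule has_derivative_bounded_linear)
      then have "\<Psi> (z + s *\<^sub>R v) (h *\<^sub>R v) = h *\<^sub>R \<Psi> (z + s *\<^sub>R v) v" for h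
        by (simp add: bounded_linear.linear linear_cmul)
      then show "onorm (\<lambda>h. \<Psi> (z + s *\<^sub>R v) (h *\<^sub>R v)) \<le> C"
        using C' C(1) by (intro onorm_le) (simp add: mult.commute[of C] mult_left_mono)
    qed auto
    then show ?thesis using that by simp
  qed
  define F where "F = (\<lambda>n z. real (Suc n) *\<^sub>R (\<psi> (z + (1 / real (Suc n)) *\<^sub>R v) - \<psi> z))"
  \<comment> \<open>The steps 1 / (n + 1) are at most 1, so a point farther than R + |v| from the
    origin cannot be moved into \<open>S\<close>; one ball serves for all difference
    quotients.\<close>
  define w :: "'a \<Rightarrow> real" where "w = (\<lambda>z. C * indicator (cball 0 (R + norm v)) z)"
  have F0: "integral\<^sup>L lborel (F n) = 0" for n
  proof -
    define x where "x = (1 / real (Suc n)) *\<^sub>R v"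
    have int: "integrable lborel \<psi>" using cont\<psi> S by (rule integrable_lborel_compact_support)
    have "integrable lborel (\<lambda>z. \<psi> (x + z))"
      using int lborel_distr_plus[of x] integrable_distr[of "(+) x" lborel borel \<psi>] by simp
    moreover have "integral\<^sup>L lborel (\<lambda>z. \<psi> (x + z)) = integral\<^sup>L lborel \<psi>"
      using integral_distr[of "(+) x" lborel borel \<psi>] lborel_distr_plus[of x] by simp
    ultimately have "integral\<^sup>L lborel (\<lambda>z. \<psi> (x + z) - \<psi> z) = 0" using int by simp
    then show ?thesis by (simp add: F_def x_def add.commute del: of_nat_Suc)
  qed
  have "(\<lambda>n. integral\<^sup>L lborel (F n)) \<longlonglongrightarrow> integral\<^sup>L lborel (\<lambda>z. \<Psi> z v)"
  proof (rule integral_dominated_convergence[where w = w])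
    show "integrable lborel w" unfolding w_def
      using emeasure_bounded_finite[OF bounded_cball]
      by (intro integrable_mult_right integrable_real_indicator) auto
    show "AE z in lborel. (\<lambda>n. F n z) \<longlonglongrightarrow> \<Psi> z v"
    proof (intro AE_I2)
      fix z
      have "((\<lambda>s. \<psi> (z + s *\<^sub>R v)) has_derivative (\<lambda>h. \<Psi> (z + 0 *\<^sub>R v) (h *\<^sub>R v))) (at 0)"
        by (rule has_derivative_compose[OF _ der]) (auto intro!: derivative_eq_intros)
      moreover have "\<Psi> z (h *\<^sub>R v) = h *\<^sub>R \<Psi> z v" for h
        using has_derivative_bounded_linear[OF der] by (simp add: bounded_linear.linear linear_cmul)
      ultimately have "((\<lambda>s. \<psi> (z + s *\<^sub>R v)) has_vector_derivative \<Psi> z v) (at 0)"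
        by (simp add: has_vector_derivative_def)
      then have "((\<lambda>s. norm (\<psi> (z + s *\<^sub>R v) - \<psi> z - s *\<^sub>R \<Psi> z v) / norm s) \<longlongrightarrow> 0) (at 0)"
        by (simp add: has_vector_derivative_def has_derivative_at)
      moreover have "eventually (\<lambda>s. norm (\<psi> (z + s *\<^sub>R v) - \<psi> z - s *\<^sub>R \<Psi> z v) / norm s =
          norm ((\<psi> (z + s *\<^sub>R v) - \<psi> z) /\<^sub>R s - \<Psi> z v)) (at 0)"
        unfolding eventually_at_filter
      proof (intro always_eventually allI impI)
        fix s :: real assume "s \<noteq> 0"
        then have "(\<psi> (z + s *\<^sub>R v) - \<psi> z) /\<^sub>R s - \<Psi> z v =
            (\<psi> (z + s *\<^sub>R v) - \<psi> z - s *\<^sub>R \<Psi> z v) /\<^sub>R s"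
          by (simp add: scaleR_diff_right)
        then show "norm (\<psi> (z + s *\<^sub>R v) - \<psi> z - s *\<^sub>R \<Psi> z v) / norm s =
            norm ((\<psi> (z + s *\<^sub>R v) - \<psi> z) /\<^sub>R s - \<Psi> z v)"
          by (simp add: divide_inverse mult.commute)
      qed
      ultimately have "((\<lambda>s. norm ((\<psi> (z + s *\<^sub>R v) - \<psi> z) /\<^sub>R s - \<Psi> z v)) \<longlongrightarrow> 0) (at 0)"
        by (rule Lim_transform_eventually)
      then have lim: "((\<lambda>s. (\<psi> (z + s *\<^sub>R v) - \<psi> z) /\<^sub>R s) \<longlongrightarrow> \<Psi> z v) (at 0)"
        by (simp add: tendsto_norm_zero_iff flip: Lim_null)
      have "filterlim (\<lambda>n. 1 / real (Suc n)) (at 0) sequentially"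
        using lim_1_over_n LIMSEQ_Suc[OF lim_1_over_n]
        by (auto simp: filterlim_at simp del: of_nat_Suc)
      from filterlim_compose[OF lim this] show "(\<lambda>n. F n z) \<longlonglongrightarrow> \<Psi> z v"
        by (simp add: F_def del: of_nat_Suc)
    qed
    show "AE z in lborel. norm (F n z) \<le> w z" for n
    proof (intro AE_I2)
      fix z
      define t where "t = 1 / real (Suc n)"
      have t: "0 < t" "t \<le> 1" by (auto simp: t_def)
      have Fz: "F n z = (1 / t) *\<^sub>R (\<psi> (z + t *\<^sub>R v) - \<psi> z)" by (simp add: F_def t_def)
      show "norm (F n z) \<le> w z"
      proof (cases "norm z \<le> R + norm v")
        case True
        then show ?thesis
          using Lip[of t z] t unfolding Fz w_def norm_scaleR by (simp add: field_simps)
      next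
        case False
        then have "z \<notin> S" using R[of z] norm_ge_zero[of v] by fastforce
        moreover have "z + t *\<^sub>R v \<notin> S"
        proof
          assume "z + t *\<^sub>R v \<in> S"
          then have "norm (z + t *\<^sub>R v) \<le> R" by (rule R)
          moreover have "norm (t *\<^sub>R v) \<le> norm v" using t by (simp add: mult_left_le_one_le)
          ultimately show False using False norm_diff_ineq[of z "t *\<^sub>R v"] by linarith
        qed
        ultimately show ?thesis using C(1) by (simp add: Fz w_def S(2))
      qed
    qed
  qed (auto simp: F_def)
  then show ?thesis unfolding F0 using LIMSEQ_unique by blast
qed

text \<open>Integration by parts: the product of f with a test function, which vanishes off a
  compact subset of U, is differentiable on the whole plane, and by the product rule its derivative
  in direction v is the sum of the two integrands. That derivative integrates to 0.\<close>

lemma weak_directional_deriv_C1: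
  assumes U: "open U" and der: "\<And>z. z \<in> U \<Longrightarrow> (f has_derivative f' z) (at z)"
    and cont: "continuous_on U (\<lambda>z. f' z v)"
  shows "weak_directional_deriv U v f (\<lambda>z. f' z v)"
  unfolding weak_directional_deriv_def
proof (intro allI impI)
  fix \<phi> assume "test_function U \<phi>"
  then obtain D where D0: "D 0 0 = \<phi>"
    and D: "\<And>i j z. (D i j has_derivative (\<lambda>v. D (Suc i) j z * Re v + D i (Suc j) z * Im v)) (at z)"
    and S: "compact (closure {z. \<phi> z \<noteq> 0})" "closure {z. \<phi> z \<noteq> 0} \<subseteq> U"
    unfolding test_function_def smooth_on_plane_def by blast
  define S where "S = closure {z. \<phi> z \<noteq> 0}"
  have S: "compact S" "S \<subseteq> U" "closed S" using S by (auto simp: S_def)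
  have \<phi>0: "\<phi> z = 0" if "z \<notin> S" for z
    using that closure_subset[of "{z. \<phi> z \<noteq> 0}"] by (auto simp: S_def)
  define d where "d = (\<lambda>z v. D 1 0 z * Re v + D 0 1 z * Im v)"
  have d: "(\<phi> has_derivative d z) (at z)" for z
    using D[of 0 0 z] by (simp add: D0 d_def)
  have d0: "d z = (\<lambda>_. 0)" if "z \<notin> S" for z
    by (rule has_derivative_zero_outside_support[OF d S(3) that \<phi>0])
  have contD: "continuous_on UNIV (D i j)" for i j
    using D by (intro has_derivative_continuous_on) auto
  have contd: "continuous_on UNIV (\<lambda>z. d z v)"
    unfolding d_def by (intro continuous_intros contD)
  have cont\<phi>: "continuous_on UNIV \<phi>" using contD[of 0 0] by (simp add: D0)
  have contf: "continuous_on U f"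
    using der U by (intro has_derivative_continuous_on[where f' = f']) (auto intro: has_derivative_at_withinI)
  have frechet: "frechet_derivative \<phi> (at z) = d z" for z
    using frechet_derivative_at[OF d] by simp
  \<comment> \<open>Nothing is known about f off U. Continuity on the plane comes from gluing over
    two open sets, U and the complement of the support, where the product is zero.\<close>
  have UNIV: "UNIV = U \<union> - S" using S(2) by auto
  have ext: "continuous_on UNIV u" if "continuous_on U u" "\<And>z. z \<notin> S \<Longrightarrow> u z = 0" for u :: "complex \<Rightarrow> complex"
  proof -
    have "continuous_on (- S) u"
      using continuous_on_cong[of "- S" "- S" u "\<lambda>_. 0"] that(2) by simp
    then show ?thesis unfolding UNIV
      using that(1) U S(3) by (intro continuous_on_open_Un) auto
  qed
  have c1: "continuous_on UNIV (\<lambda>z. d z v *\<^sub>R f z)"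
    by (rule ext) (use d0 in \<open>auto intro!: continuous_intros contf continuous_on_subset[OF contd]\<close>)
  have c2: "continuous_on UNIV (\<lambda>z. \<phi> z *\<^sub>R f' z v)"
    by (rule ext) (use \<phi>0 in \<open>auto intro!: continuous_intros cont continuous_on_subset[OF cont\<phi>]\<close>)
  have i1: "integrable lborel (\<lambda>z. d z v *\<^sub>R f z)"
    by (rule integrable_lborel_compact_support[OF c1 S(1)]) (simp add: d0)
  have i2: "integrable lborel (\<lambda>z. \<phi> z *\<^sub>R f' z v)"
    by (rule integrable_lborel_compact_support[OF c2 S(1)]) (simp add: \<phi>0)
  \<comment> \<open>The value 0 off U is the true derivative there, since the product vanishes near
    such points, while \<open>f'\<close> carries no information outside U.\<close>
  define \<Psi> where "\<Psi> = (\<lambda>z w. if z \<in> U then d z w *\<^sub>R f z + \<phi> z *\<^sub>R f' z w else 0)"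
  have \<Psi>v: "\<Psi> z v = d z v *\<^sub>R f z + \<phi> z *\<^sub>R f' z v" for z
    using S(2) d0[of z] \<phi>0[of z] by (cases "z \<in> S") (auto simp: \<Psi>_def)
  have "integral\<^sup>L lborel (\<lambda>z. \<Psi> z v) = 0"
  proof (rule integral_derivative_compact_support[where \<psi> = "\<lambda>z. \<phi> z *\<^sub>R f z" and S = S])
    fix z
    show "((\<lambda>z. \<phi> z *\<^sub>R f z) has_derivative \<Psi> z) (at z)"
    proof (cases "z \<in> U")
      case True
      have "((\<lambda>z. \<phi> z *\<^sub>R f z) has_derivative (\<lambda>w. \<phi> z *\<^sub>R f' z w + d z w *\<^sub>R f z)) (at z)"
        by (rule has_derivative_scaleR[OF d der[OF True]])
      then show ?thesis using True by (simp add: \<Psi>_def add.commute)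
    next
      case False
      have "((\<lambda>z. \<phi> z *\<^sub>R f z) has_derivative (\<lambda>_. 0)) (at z)"
        by (rule has_derivative_transform_within_open[of "\<lambda>_. 0" _ _ _ "- S"])
           (use S False \<phi>0 in auto)
      then show ?thesis using False by (simp add: \<Psi>_def)
    qed
  next
    show "continuous_on UNIV (\<lambda>z. \<Psi> z v)" unfolding \<Psi>v by (intro continuous_intros c1 c2)
  qed (auto simp: S \<phi>0)
  then have sum0: "integral\<^sup>L lborel (\<lambda>z. d z v *\<^sub>R f z) + integral\<^sup>L lborel (\<lambda>z. \<phi> z *\<^sub>R f' z v) = 0"
    unfolding \<Psi>v using i1 i2 by simp
  \<comment> \<open>Restricting to U changes nothing for an integrand supported in \<open>S\<close>,
    and a Borel function has the same integral for the completed measure.\<close>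
  have leb: "(LINT z:U|lebesgue. u z) = integral\<^sup>L lborel u"
    if "continuous_on UNIV u" "\<And>z. z \<notin> S \<Longrightarrow> u z = 0" for u :: "complex \<Rightarrow> complex"
  proof -
    have "(\<lambda>z. indicator U z *\<^sub>R u z) = u"
      using that(2) S(2) by (auto simp: fun_eq_iff indicator_def)
    then show ?thesis
      using that(1) by (simp add: set_lebesgue_integral_def integral_completion borel_measurable_continuous_onI)
  qed
  have "(LINT z:U|lebesgue. d z v *\<^sub>R f z) = integral\<^sup>L lborel (\<lambda>z. d z v *\<^sub>R f z)"
    by (rule leb[OF c1]) (simp add: d0)
  moreover have "(LINT z:U|lebesgue. \<phi> z *\<^sub>R f' z v) = integral\<^sup>L lborel (\<lambda>z. \<phi> z *\<^sub>R f' z v)"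
    by (rule leb[OF c2]) (simp add: \<phi>0)
  ultimately show "(LINT z:U|lebesgue. frechet_derivative \<phi> (at z) v *\<^sub>R f z) =
      - (LINT z:U|lebesgue. \<phi> z *\<^sub>R f' z v)"
    using sum0 by (simp add: frechet eq_neg_iff_add_eq_0)
qed

lemma L2_loc_continuous:
  assumes "open U" "continuous_on U f"
  shows "L2_loc U f"
  unfolding L2_loc_def
proof (intro conjI allI impI)
  show "f \<in> borel_measurable (lebesgue_on U)"
    using assms by (intro continuous_imp_measurable_on_sets_lebesgue) auto
  fix C assume C: "compact C \<and> C \<subseteq> U"
  then have "integrable lborel (\<lambda>z. indicator C z *\<^sub>R (norm (f z))\<^sup>2)"
    using assms by (intro borel_integrable_compact continuous_intros) (auto intro: continuous_on_subset)
  then show "set_integrable lebesgue C (\<lambda>z. (norm (f z))\<^sup>2)"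
    unfolding set_integrable_def by (subst integrable_completion) auto
qed

section \<open>Derivatives and Sobolev regularity of harmonic maps\<close>

lemma harmonic_map_has_derivative:
  assumes "open U" "h holomorphic_on U" "g holomorphic_on U" "z \<in> U"
  shows "(harmonic_map h g has_derivative (\<lambda>v. deriv h z * v + cnj (deriv g z * v))) (at z)"
proof -
  have "(h has_derivative (\<lambda>v. deriv h z * v)) (at z)" "(g has_derivative (\<lambda>v. deriv g z * v)) (at z)"
    using holomorphic_derivI[OF assms(2,1,4)] holomorphic_derivI[OF assms(3,1,4)]
    by (simp_all add: has_field_derivative_def)
  then show ?thesis
    unfolding harmonic_map_def by (intro derivative_intros has_derivative_cnj)
qed

lemma wirtinger_harmonic_map:
  assumes "open U" "h holomorphic_on U" "g holomorphic_on U" "z \<in> U"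
  shows "wirtinger (harmonic_map h g) z = deriv h z"
    "wirtinger_bar (harmonic_map h g) z = cnj (deriv g z)"
  unfolding wirtinger_def wirtinger_bar_def
    frechet_derivative_at[OF harmonic_map_has_derivative[OF assms], symmetric]
  by (simp_all add: algebra_simps)

lemma W12_loc_harmonic_map:
  assumes U: "open U" and hol: "h holomorphic_on U" "g holomorphic_on U"
  shows "W12_loc U (harmonic_map h g)"
proof -
  define f' where "f' = (\<lambda>z v. deriv h z * v + cnj (deriv g z * v))"
  have der: "(harmonic_map h g has_derivative f' z) (at z)" if "z \<in> U" for z
    unfolding f'_def by (rule harmonic_map_has_derivative[OF U hol that])
  have cont: "continuous_on U (\<lambda>z. f' z v)" for v
    unfolding f'_def
    by (intro continuous_intros holomorphic_on_imp_continuous_on holomorphic_deriv hol U)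
  have "continuous_on U (harmonic_map h g)"
    unfolding harmonic_map_def by (intro continuous_intros holomorphic_on_imp_continuous_on hol)
  then show ?thesis
    unfolding W12_loc_def
    using L2_loc_continuous[OF U] cont weak_directional_deriv_C1[OF U der cont] by blast
qed

section \<open>The extremal maps\<close>

text \<open>The involutive disc automorphism interchanging 0 and a, which is the negative of
  \<open>Moebius_function 0 a\<close>. The sign makes the constant coefficient positive and all
  later ones negative.\<close>

definition extremal_map :: "real \<Rightarrow> complex \<Rightarrow> complex" where
  "extremal_map a z = (of_real a - z) / (1 - of_real a * z)"

text \<open>Geometric expansion of (a - z) / (1 - a z) = a - (1 - a^2) z / (1 - a z).\<close>

definition extremal_coeff :: "real \<Rightarrow> nat \<Rightarrow> complex" where
  "extremal_coeff a n = (case n of 0 \<Rightarrow> of_real a | Suc m \<Rightarrow> - of_real ((1 - a\<^sup>2) * a ^ m))"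

context
  fixes a :: real
  assumes a: "0 < a" "a < 1"
begin

lemma extremal_map_denominator:
  fixes z :: complex
  assumes "norm z < 1"
  shows "1 - of_real a * z \<noteq> 0"
proof -
  have "norm (of_real a * z) < 1" using a assms norm_mult_less[of "of_real a" 1 z 1] by simp
  then show ?thesis by force
qed

lemma extremal_map_holomorphic: "extremal_map a holomorphic_on unit_disc"
  unfolding extremal_map_def using extremal_map_denominator by (intro holomorphic_intros) auto

lemma extremal_map_norm_less: "norm z < 1 \<Longrightarrow> norm (extremal_map a z) < 1"
  using Moebius_function_norm_lt_1[of "of_real a" z 0] a
  by (simp add: extremal_map_def Moebius_function_simple norm_divide norm_minus_commute)

lemma extremal_map_inj: "inj_on (extremal_map a) unit_disc"
proof (rule inj_onI)
  fix z w assume z: "z \<in> unit_disc" and w: "w \<in> unit_disc" and eq: "extremal_map a z = extremal_map a w"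
  have "(of_real a - z) * (1 - of_real a * w) = (of_real a - w) * (1 - of_real a * z)"
    using eq extremal_map_denominator[of z] extremal_map_denominator[of w] z w
    by (simp add: extremal_map_def frac_eq_eq)
  then have "(1 - of_real (a\<^sup>2)) * (w - z) = 0"
    by (simp add: algebra_simps power2_eq_square)
  moreover have "(1 - of_real (a\<^sup>2) :: complex) \<noteq> 0"
  proof -
    have "a\<^sup>2 \<noteq> 1" using a by (simp add: power2_eq_1_iff)
    then show ?thesis by (metis of_real_eq_1_iff right_minus_eq)
  qed
  ultimately show "z = w" by simp
qed

lemma extremal_map_sums:
  assumes "norm z < 1"
  shows "(\<lambda>n. extremal_coeff a (Suc n) * z ^ Suc n) sums (extremal_map a z - of_real a)"
proof -
  have "norm (of_real a * z) < 1" using a assms norm_mult_less[of "of_real a" 1 z 1] by simp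
  then have "(\<lambda>n. - of_real (1 - a\<^sup>2) * z * (of_real a * z) ^ n) sums
      (- of_real (1 - a\<^sup>2) * z * (1 / (1 - of_real a * z)))"
    by (intro sums_mult geometric_sums)
  also have "- of_real (1 - a\<^sup>2) * z * (1 / (1 - of_real a * z)) = extremal_map a z - of_real a"
    using extremal_map_denominator[OF assms]
    by (simp add: extremal_map_def divide_simps) (simp add: algebra_simps power2_eq_square)
  also have "(\<lambda>n. - of_real (1 - a\<^sup>2) * z * (of_real a * z) ^ n) = (\<lambda>n. extremal_coeff a (Suc n) * z ^ Suc n)"
    by (simp add: extremal_coeff_def power_mult_distrib fun_eq_iff algebra_simps)
  finally show ?thesis .
qed

text \<open>Here g' = k h', so the distortion quotient equals (1 + k) / (1 - k) = K at every point.
  Injectivity reduces to that of h because w + k cnj w determines w when k < 1.\<close>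

lemma qc_harmonic_series_extremal:
  assumes K: "K \<ge> 1" and k: "k = (K - 1) / (K + 1)"
  shows "qc_harmonic_series K (extremal_coeff a) (\<lambda>n. of_real k * extremal_coeff a n)
    (extremal_map a) (\<lambda>z. of_real k * (extremal_map a z - of_real a))"
proof -
  define h where "h = extremal_map a"
  define g where "g = (\<lambda>z. of_real k * (h z - of_real a))"
  have k01: "0 \<le> k" "k < 1" using K by (auto simp: k)
  have holh: "h holomorphic_on unit_disc" unfolding h_def by (rule extremal_map_holomorphic)
  have holg: "g holomorphic_on unit_disc" unfolding g_def by (intro holomorphic_intros holh)
  \<comment> \<open>An injective holomorphic function has no critical points.\<close>
  have dh: "deriv h z \<noteq> 0" if "z \<in> unit_disc" for z
    using holomorphic_injective_imp_regular[OF holh open_ball _ that] extremal_map_inj by (simp add: h_def)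
  have dg: "deriv g z = of_real k * deriv h z" if "z \<in> unit_disc" for z
    unfolding g_def
    by (rule DERIV_imp_deriv) (auto intro!: derivative_eq_intros holomorphic_derivI[OF holh open_ball that])
  have ndg: "norm (deriv g z) = k * norm (deriv h z)" if "z \<in> unit_disc" for z
    using dg[OF that] k01 by (simp add: norm_mult)
  have "sense_preserving_harmonic h g"
    unfolding sense_preserving_harmonic_def
  proof (intro conjI ballI holh holg)
    show "g 0 = 0" by (simp add: g_def h_def extremal_map_def)
    fix z assume z: "z \<in> unit_disc"
    have "(norm (deriv h z))\<^sup>2 - (norm (deriv g z))\<^sup>2 = (1 - k\<^sup>2) * (norm (deriv h z))\<^sup>2"
      by (simp add: ndg[OF z] power_mult_distrib algebra_simps)
    also have "\<dots> > 0" using k01 dh[OF z] by (simp add: power_less_one_iff abs_square_less_1)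
    finally show "(norm (deriv h z))\<^sup>2 - (norm (deriv g z))\<^sup>2 > 0" .
  qed
  moreover have "\<exists>V f'. open V \<and> connected V \<and> homeomorphism unit_disc V (harmonic_map h g) f'"
  proof -
    have cont: "continuous_on unit_disc (harmonic_map h g)"
      unfolding harmonic_map_def
      by (intro continuous_intros holomorphic_on_imp_continuous_on holh holg)
    have inj: "inj_on (harmonic_map h g) unit_disc"
    proof (rule inj_onI)
      fix z w assume z: "z \<in> unit_disc" and w: "w \<in> unit_disc"
        and eq: "harmonic_map h g z = harmonic_map h g w"
      \<comment> \<open>Taking moduli gives |h z - h w| = k |h z - h w|, and k < 1 forces the
        difference to vanish.\<close>
      then have "h z - h w = - of_real k * cnj (h z - h w)"
        by (simp add: harmonic_map_def g_def algebra_simps add_eq_0_iff)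
      then have "norm (h z - h w) = k * norm (h z - h w)"
        by (metis abs_of_nonneg complex_mod_cnj k01(1) norm_minus_cancel norm_mult norm_of_real mult_minus_left)
      then have "h z = h w" using k01 by simp
      then show "z = w" using extremal_map_inj z w by (auto simp: h_def dest: inj_onD)
    qed
    \<comment> \<open>Invariance of domain supplies both the continuous inverse and the openness of
      the image.\<close>
    obtain f' where "homeomorphism unit_disc (harmonic_map h g ` unit_disc) (harmonic_map h g) f'"
      using invariance_of_domain_homeomorphism[OF open_ball cont _ inj] by auto
    moreover have "open (harmonic_map h g ` unit_disc)"
      using invariance_of_domain[OF cont open_ball inj] .
    moreover have "connected (harmonic_map h g ` unit_disc)"
      by (intro connected_continuous_image cont connected_ball)
    ultimately show ?thesis by blast
  qed
  moreover have "W12_loc unit_disc (harmonic_map h g)"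
    by (rule W12_loc_harmonic_map[OF open_ball holh holg])
  moreover have "(norm (wirtinger (harmonic_map h g) z) + norm (wirtinger_bar (harmonic_map h g) z)) /
        (norm (wirtinger (harmonic_map h g) z) - norm (wirtinger_bar (harmonic_map h g) z)) \<le> K"
    if z: "z \<in> unit_disc" for z
  proof -
    define m where "m = norm (deriv h z)"
    have m: "m > 0" using dh[OF z] by (simp add: m_def)
    have "(m + k * m) / (m - k * m) = (m * (1 + k)) / (m * (1 - k))" by (simp add: algebra_simps)
    also have "\<dots> = (1 + k) / (1 - k)" using m by simp
    also have "\<dots> = K" using K by (simp add: k divide_simps) 
    finally show ?thesis
      by (simp add: wirtinger_harmonic_map[OF open_ball holh holg z] ndg[OF z] m_def)
  qed
  ultimately have "quasiconformal_harmonic K h g" unfolding quasiconformal_harmonic_def by blast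
  moreover have "bounded (h ` unit_disc)"
    using extremal_map_norm_less by (auto simp: h_def bounded_iff intro!: exI[of _ 1] less_imp_le)
  moreover have "(\<lambda>n. extremal_coeff a n * z ^ n) sums h z" if "z \<in> unit_disc" for z
    using sums_Suc[OF extremal_map_sums[of z]] that by (simp add: h_def extremal_coeff_def)
  moreover have "(\<lambda>n. of_real k * extremal_coeff a (Suc n) * z ^ Suc n) sums g z" if "z \<in> unit_disc" for z
    using sums_mult[OF extremal_map_sums[of z], of "of_real k"] that by (simp add: g_def h_def mult.assoc)
  ultimately show ?thesis unfolding qc_harmonic_series_def h_def g_def by blast
qed

text \<open>This direction suffices: sharpness exhibits a left-hand side exceeding 1.\<close>

lemma disc_sup_norm_extremal: "disc_sup_norm (extremal_map a) \<le> 1"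
  unfolding disc_sup_norm_def
  by (rule cSUP_least) (auto intro: less_imp_le extremal_map_norm_less)

lemma norm_extremal_map_neg:
  assumes "0 \<le> r"
  shows "norm (extremal_map a (- of_real r)) = (a + r) / (1 + a * r)"
proof -
  have "extremal_map a (- of_real r) = of_real ((a + r) / (1 + a * r))" by (simp add: extremal_map_def)
  moreover have "0 \<le> (a + r) / (1 + a * r)" using a assms by simp
  ultimately show ?thesis by (simp only: norm_of_real abs_of_nonneg)
qed

lemma majorant_extremal:
  assumes "0 \<le> r" "r < 1" "0 \<le> k"
  shows "(\<Sum>n. majorant_term (extremal_coeff a) (\<lambda>n. of_real k * extremal_coeff a n) r n) =
    (1 + k) * (1 - a\<^sup>2) * r / (1 - a * r)"
proof -
  have "a * r < 1" using a assms mult_strict_mono'[of a 1 r 1] by simp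
  then have "(\<lambda>n. (1 + k) * (1 - a\<^sup>2) * r * (a * r) ^ n) sums ((1 + k) * (1 - a\<^sup>2) * r * (1 / (1 - a * r)))"
    using a assms by (intro sums_mult geometric_sums) auto
  moreover have "majorant_term (extremal_coeff a) (\<lambda>n. of_real k * extremal_coeff a n) r n =
      (1 + k) * (1 - a\<^sup>2) * r * (a * r) ^ n" for n
  proof -
    have "norm (extremal_coeff a (Suc n)) = (1 - a\<^sup>2) * a ^ n"
    proof -
      have "a\<^sup>2 \<le> 1" using a by (simp add: power_le_one)
      then have "0 \<le> (1 - a\<^sup>2) * a ^ n" using a by simp
      then show ?thesis
        unfolding extremal_coeff_def nat.case norm_minus_cancel norm_of_real by (rule abs_of_nonneg)
    qed
    then show ?thesis using assms(3)
      by (simp add: majorant_term_def norm_mult power_mult_distrib) (simp add: algebra_simps)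
  qed
  ultimately show ?thesis by (simp add: sums_iff)
qed

end

section \<open>The radii\<close>

text \<open>On [0,1] the left side is strictly increasing. It is -1 at 0 and 4 (s - 1) / 9 at 1/3,
  so s >= 1 is what places the root within the Bohr radius.\<close>

lemma radius_equation:
  fixes s :: real
  assumes s: "s \<ge> 1"
  obtains r0 where "{r\<in>{0<..<1}. s * r * (1 + r) - (1 - r)\<^sup>2 = 0} = {r0}"
    "0 < r0" "r0 \<le> 1 / 3"
    "\<And>r. 0 \<le> r \<Longrightarrow> r \<le> r0 \<Longrightarrow> s * r * (1 + r) \<le> (1 - r)\<^sup>2"
    "\<And>r. r0 < r \<Longrightarrow> r < 1 \<Longrightarrow> s * r * (1 + r) > (1 - r)\<^sup>2"
proof -
  define q where "q = (\<lambda>r. s * r * (1 + r) - (1 - r)\<^sup>2)"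
  have mono: "q x < q y" if "0 \<le> x" "x < y" "y \<le> 1" for x y
  proof -
    have "s * (x * (1 + x)) < s * (y * (1 + y))"
      using that s by (intro mult_strict_left_mono mult_strict_mono) auto
    moreover have "(1 - y)\<^sup>2 < (1 - x)\<^sup>2" using that by (intro power_strict_mono) auto
    ultimately show ?thesis by (simp add: q_def mult.assoc)
  qed
  have "\<exists>r. 0 \<le> r \<and> r \<le> 1 / 3 \<and> q r = 0"
  proof (rule IVT')
    show "continuous_on {0..1 / 3} q" unfolding q_def by (intro continuous_intros)
    show "0 \<le> q (1 / 3)" using s by (simp add: q_def power2_eq_square)
  qed (auto simp: q_def)
  then obtain r0 where r0: "0 \<le> r0" "r0 \<le> 1 / 3" "q r0 = 0" by blast
  have "r0 \<noteq> 0" using r0(3) by (auto simp: q_def)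
  then have pos: "0 < r0" using r0(1) by simp
  show ?thesis
  proof (rule that)
    show "{r\<in>{0<..<1}. s * r * (1 + r) - (1 - r)\<^sup>2 = 0} = {r0}"
    proof (intro equalityI subsetI)
      fix r assume "r \<in> {r\<in>{0<..<1}. s * r * (1 + r) - (1 - r)\<^sup>2 = 0}"
      then have "0 < r" "r < 1" "q r = 0" by (auto simp: q_def)
      then show "r \<in> {r0}" using mono[of r r0] mono[of r0 r] r0 by (cases r r0 rule: linorder_cases) auto
    qed (use r0 pos in \<open>auto simp: q_def\<close>)
    show "s * r * (1 + r) \<le> (1 - r)\<^sup>2" if "0 \<le> r" "r \<le> r0" for r
      using mono[of r r0] r0 that by (cases "r = r0") (auto simp: q_def)
    show "s * r * (1 + r) > (1 - r)\<^sup>2" if "r0 < r" "r < 1" for r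
      using mono[of r0 r] r0 that by (auto simp: q_def)
  qed (use r0 pos in auto)
qed

text \<open>Since 1 - (t + r) / (1 + t r) = (1 - t) (1 - r) / (1 + t r), a factor 1 - t can be taken
  out. What remains is s r (1 + t) (1 + t r) <= (1 - r)^2, whose left side increases with t.\<close>

lemma schwarz_majorant_ineq:
  fixes s t r :: real
  assumes t: "0 \<le> t" "t \<le> 1" and r: "0 \<le> r" "r < 1" and s: "0 \<le> s"
    and le: "2 * s * r * (1 + r) \<le> (1 - r)\<^sup>2"
  shows "(t + r) / (1 + t * r) + s * (1 - t\<^sup>2) * (r / (1 - r)) \<le> 1"
proof -
  have pos: "0 < 1 + t * r" using t r by (simp add: add_pos_nonneg)
  have "s * r * ((1 + t) * (1 + t * r)) \<le> s * r * (2 * (1 + r))"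
    using t r s by (intro mult_left_mono mult_mono) (auto simp: mult_left_le_one_le)
  also have "\<dots> \<le> (1 - r)\<^sup>2" using le by (simp add: algebra_simps)
  finally have "s * r * (1 + t) * (1 + t * r) \<le> (1 - r) * (1 - r)"
    by (simp add: mult.assoc power2_eq_square)
  then have "s * r * (1 + t) / (1 - r) \<le> (1 - r) / (1 + t * r)"
    using pos r by (simp add: frac_le_eq divide_le_eq le_divide_eq pos_le_divide_eq pos_divide_le_eq mult.commute)
  then have "(1 - t) * (s * r * (1 + t) / (1 - r)) \<le> (1 - t) * ((1 - r) / (1 + t * r))"
    using t by (intro mult_left_mono) auto
  also have "(1 - t) * ((1 - r) / (1 + t * r)) = 1 - (t + r) / (1 + t * r)"
    using pos by (simp add: field_simps)
  also have "(1 - t) * (s * r * (1 + t) / (1 - r)) = s * (1 - t\<^sup>2) * (r / (1 - r))"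
  proof -
    have "1 - t\<^sup>2 = (1 - t) * (1 + t)" by (simp add: power2_eq_square algebra_simps)
    then show ?thesis by (simp add: mult_ac)
  qed
  finally show ?thesis by simp
qed

text \<open>Squaring turns the deficit into (1 - t^2) (1 - r^2) / (1 + t r)^2, so the whole factor 1
  - t^2 can be taken out. What remains, s r (1 + t r)^2 <= (1 - r^2) (1 - r), is tightest at t = 1,
  where it is the hypothesis times 1 + r.\<close>

lemma schwarz_sq_majorant_ineq:
  fixes s t r :: real
  assumes t: "0 \<le> t" "t \<le> 1" and r: "0 \<le> r" "r < 1" and s: "0 \<le> s"
    and le: "s * r * (1 + r) \<le> (1 - r)\<^sup>2"
  shows "((t + r) / (1 + t * r))\<^sup>2 + s * (1 - t\<^sup>2) * (r / (1 - r)) \<le> 1"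
proof -
  have pos: "0 < 1 + t * r" using t r by (simp add: add_pos_nonneg)
  have "s * r * (1 + t * r)\<^sup>2 \<le> s * r * (1 + r)\<^sup>2"
    using t r s by (intro mult_left_mono power_mono) (auto simp: mult_left_le_one_le)
  also have "\<dots> = s * r * (1 + r) * (1 + r)" by (simp add: power2_eq_square)
  also have "\<dots> \<le> (1 - r)\<^sup>2 * (1 + r)" using le r by (intro mult_right_mono) auto
  also have "\<dots> = (1 - r\<^sup>2) * (1 - r)" by (simp add: power2_eq_square algebra_simps)
  finally have "s * (r / (1 - r)) \<le> (1 - r\<^sup>2) / (1 + t * r)\<^sup>2"
    using pos r by (simp add: pos_le_divide_eq pos_divide_le_eq)
  then have "(1 - t\<^sup>2) * (s * (r / (1 - r))) \<le> (1 - t\<^sup>2) * ((1 - r\<^sup>2) / (1 + t * r)\<^sup>2)"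
    using t by (intro mult_left_mono) (auto simp: power_le_one)
  also have "(1 - t\<^sup>2) * ((1 - r\<^sup>2) / (1 + t * r)\<^sup>2) = 1 - ((t + r) / (1 + t * r))\<^sup>2"
  proof -
    have "(1 + t * r)\<^sup>2 - (t + r)\<^sup>2 = (1 - t\<^sup>2) * (1 - r\<^sup>2)" by (simp add: power2_eq_square algebra_simps)
    moreover have "1 - ((t + r) / (1 + t * r))\<^sup>2 = ((1 + t * r)\<^sup>2 - (t + r)\<^sup>2) / (1 + t * r)\<^sup>2"
      using pos by (simp add: power_divide diff_divide_distrib)
    ultimately show ?thesis by simp
  qed
  finally show ?thesis by (simp add: mult_ac)
qed

section \<open>Estimates for quasiconformal harmonic maps\<close>

lemma qc_dilatation_bound:
  assumes qc: "quasiconformal_harmonic K h g" and K: "K \<ge> 1" and k: "k = (K - 1) / (K + 1)"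
    and z: "z \<in> unit_disc"
  shows "norm (deriv g z) \<le> k * norm (deriv h z)" "deriv h z \<noteq> 0"
proof -
  have sp: "sense_preserving_harmonic h g" using qc by (simp add: quasiconformal_harmonic_def)
  then have hol: "h holomorphic_on unit_disc" "g holomorphic_on unit_disc"
    and J: "(norm (deriv h z))\<^sup>2 - (norm (deriv g z))\<^sup>2 > 0"
    using z by (auto simp: sense_preserving_harmonic_def)
  \<comment> \<open>The positive Jacobian makes the denominator of the distortion quotient positive,
    so that the bound K can be multiplied out.\<close>
  have lt: "norm (deriv g z) < norm (deriv h z)" by (rule power2_less_imp_less) (use J in auto)
  then show "deriv h z \<noteq> 0" by auto
  have "(norm (deriv h z) + norm (deriv g z)) / (norm (deriv h z) - norm (deriv g z)) \<le> K"
    using bspec[OF conjunct2[OF conjunct2[OF conjunct2[OF qc[unfolded quasiconformal_harmonic_def]]]] z]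
    by (simp add: wirtinger_harmonic_map[OF open_ball hol z])
  then have "norm (deriv h z) + norm (deriv g z) \<le> K * (norm (deriv h z) - norm (deriv g z))"
    using lt by (simp add: pos_divide_le_eq)
  then have "norm (deriv g z) * (K + 1) \<le> (K - 1) * norm (deriv h z)" by (simp add: algebra_simps)
  then show "norm (deriv g z) \<le> k * norm (deriv h z)" using K by (simp add: k pos_le_divide_eq)
qed

text \<open>By the maximum modulus principle an attained supremum would make h constant, against
  \<open>deriv h 0 \<noteq> 0\<close>. The strict bound is what the coefficient and Schwarz-Pick
  estimates ask for, and it also gives a positive sup norm.\<close>

lemma disc_sup_norm_strict:
  assumes hol: "h holomorphic_on unit_disc" and bdd: "bounded (h ` unit_disc)"
    and nz: "deriv h 0 \<noteq> 0" and z: "norm z < 1"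
  shows "norm (h z) < disc_sup_norm h"
proof (rule ccontr)
  have "bdd_above ((\<lambda>z. norm (h z)) ` unit_disc)"
    using bdd by (auto simp: bounded_iff bdd_above_def)
  then have le: "norm (h w) \<le> disc_sup_norm h" if "w \<in> unit_disc" for w
    unfolding disc_sup_norm_def using that by (rule cSUP_upper[rotated])
  assume "\<not> norm (h z) < disc_sup_norm h"
  then have "norm (h w) \<le> norm (h z)" if "w \<in> unit_disc" for w using le[OF that] by simp
  then have "h constant_on unit_disc"
    using z by (intro maximum_modulus_principle[OF hol open_ball connected_ball open_ball order_refl, of z]) auto
  then obtain c where c: "\<And>w. w \<in> unit_disc \<Longrightarrow> h w = c" by (auto simp: constant_on_def)
  have "deriv h 0 = deriv (\<lambda>_. c) 0"
    by (rule complex_derivative_transform_within_open[OF hol _ open_ball]) (auto simp: c)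
  then show False using nz by simp
qed

text \<open>Collects everything analytic: what is left afterwards is an inequality in the real
  numbers t and |z|. The witness is t = |h 0| / M, of which only the range matters.\<close>

lemma qc_harmonic_series_bounds:
  assumes qc: "qc_harmonic_series K a b h g" and K: "K \<ge> 1" and k: "k = (K - 1) / (K + 1)"
    and z: "norm z \<le> 1 / 3"
  obtains M t where "M = disc_sup_norm h" "M > 0" "0 \<le> t" "t \<le> 1"
    "summable (majorant_term a b (norm z))"
    "norm (h z) \<le> M * ((t + norm z) / (1 + t * norm z))"
    "(\<Sum>n. majorant_term a b (norm z) n) \<le> M * ((k + 1) * (1 - t\<^sup>2) * (norm z / (1 - norm z)))"
proof -
  define M where "M = disc_sup_norm h"
  define t where "t = norm (h 0) / M"
  have qch: "quasiconformal_harmonic K h g" and bdd: "bounded (h ` unit_disc)"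
    and sums: "\<And>z. norm z < 1 \<Longrightarrow> (\<lambda>n. a n * z ^ n) sums h z"
      "\<And>z. norm z < 1 \<Longrightarrow> (\<lambda>n. b (Suc n) * z ^ Suc n) sums g z"
    using qc by (auto simp: qc_harmonic_series_def)
  have hol: "h holomorphic_on unit_disc" "g holomorphic_on unit_disc"
    using qch by (auto simp: quasiconformal_harmonic_def sense_preserving_harmonic_def)
  note dil = qc_dilatation_bound[OF qch K k]
  have less: "norm (h w) < M" if "norm w < 1" for w
    unfolding M_def using dil(2)[of 0] by (intro disc_sup_norm_strict hol bdd that) auto
  have M: "M > 0" using le_less_trans[OF norm_ge_zero less[of 0]] by simp
  have k0: "k \<ge> 0" using K by (simp add: k)
  have z1: "norm z < 1" using z by simp
  show ?thesis
  proof (rule that[of M t])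
    show "0 \<le> t" "t \<le> 1" using less[of 0] M by (auto simp: t_def)
    show "norm (h z) \<le> M * ((t + norm z) / (1 + t * norm z))"
      unfolding t_def by (rule Schwarz_Pick_bound_scaled[OF hol(1) less z1])
    show "summable (majorant_term a b (norm z))"
      by (rule majorant_bound(1)[OF hol _ _ less sums norm_ge_zero z k0]) (use dil in auto)
    show "(\<Sum>n. majorant_term a b (norm z) n) \<le> M * ((k + 1) * (1 - t\<^sup>2) * (norm z / (1 - norm z)))"
      unfolding t_def add.commute[of k 1]
      by (rule majorant_bound(2)[OF hol _ _ less sums norm_ge_zero z k0]) (use dil in auto)
  qed (use M in \<open>auto simp: M_def\<close>)
qed

section \<open>Failure of the inequalities beyond the radii\<close>

lemma schwarz_majorant_exceeds_one:
  fixes s r :: real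
  assumes s: "0 \<le> s" and r: "0 < r" "r < 1" and gt: "2 * s * r * (1 + r) > (1 - r)\<^sup>2"
  obtains a where "0 < a" "a < 1" "(a + r) / (1 + a * r) + s * (1 - a\<^sup>2) * r / (1 - a * r) > 1"
proof -
  \<comment> \<open>At a = 1 the desired inequality degenerates to an equality, so 1 - a is divided
    out first. The quotient condition is continuous in a and at a = 1 is exactly the assumption on
    r, hence it holds for some a < 1.\<close>
  have "((\<lambda>a. s * (1 + a) * r * (1 + a * r) - (1 - r) * (1 - a * r)) \<longlongrightarrow>
      s * (1 + 1) * r * (1 + 1 * r) - (1 - r) * (1 - 1 * r)) (at_left 1)"
    by (intro tendsto_intros)
  moreover have "0 < s * (1 + 1) * r * (1 + 1 * r) - (1 - r) * (1 - 1 * r)"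
    using gt by (simp add: power2_eq_square mult_ac)
  ultimately have "eventually (\<lambda>a. 0 < s * (1 + a) * r * (1 + a * r) - (1 - r) * (1 - a * r)) (at_left 1)"
    by (rule order_tendstoD)
  moreover have "eventually (\<lambda>a::real. a \<in> {0<..<1}) (at_left 1)"
    by (rule eventually_at_left_real) simp
  ultimately have "eventually (\<lambda>a. a \<in> {0<..<1} \<and> 0 < s * (1 + a) * r * (1 + a * r) - (1 - r) * (1 - a * r)) (at_left 1)"
    by eventually_elim simp
  then obtain a where a: "0 < a" "a < 1" and gt: "(1 - r) * (1 - a * r) < s * (1 + a) * r * (1 + a * r)"
    using eventually_happens'[OF trivial_limit_at_left_real] by force
  have pos: "0 < 1 + a * r" "0 < 1 - a * r"
    using a r mult_strict_mono'[of a 1 r 1] by (auto intro: add_pos_nonneg)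
  have "(1 - r) / (1 + a * r) < s * (1 + a) * r / (1 - a * r)"
    using gt pos by (simp add: pos_less_divide_eq pos_divide_less_eq)
  then have "(1 - a) * ((1 - r) / (1 + a * r)) < (1 - a) * (s * (1 + a) * r / (1 - a * r))"
    using a by (intro mult_strict_left_mono) auto
  also have "\<dots> = s * (1 - a\<^sup>2) * r / (1 - a * r)"
  proof -
    have "1 - a\<^sup>2 = (1 - a) * (1 + a)" by (simp add: power2_eq_square algebra_simps)
    then show ?thesis by (simp add: mult_ac)
  qed
  also have "(1 - a) * ((1 - r) / (1 + a * r)) = 1 - (a + r) / (1 + a * r)"
    using pos by (simp add: field_simps)
  finally show ?thesis using a by (intro that) auto
qed

lemma schwarz_sq_majorant_exceeds_one:
  fixes s r :: real
  assumes s: "0 \<le> s" and r: "0 < r" "r < 1" and gt: "s * r * (1 + r) > (1 - r)\<^sup>2"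
  obtains a where "0 < a" "a < 1" "((a + r) / (1 + a * r))\<^sup>2 + s * (1 - a\<^sup>2) * r / (1 - a * r) > 1"
proof -
  \<comment> \<open>Again a limit from the left at 1, now after dividing out 1 - a^2. The limit
    value is the assumed gap multiplied by 1 + r.\<close>
  have "((\<lambda>a. s * r * (1 + a * r)\<^sup>2 - (1 - r\<^sup>2) * (1 - a * r)) \<longlongrightarrow>
      s * r * (1 + 1 * r)\<^sup>2 - (1 - r\<^sup>2) * (1 - 1 * r)) (at_left 1)"
    by (intro tendsto_intros)
  moreover have "0 < s * r * (1 + 1 * r)\<^sup>2 - (1 - r\<^sup>2) * (1 - 1 * r)"
  proof -
    have "0 < (1 + r) * (s * r * (1 + r) - (1 - r)\<^sup>2)" using gt r by simp
    also have "\<dots> = s * r * (1 + 1 * r)\<^sup>2 - (1 - r\<^sup>2) * (1 - 1 * r)"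
      by (simp add: power2_eq_square algebra_simps)
    finally show ?thesis .
  qed
  ultimately have "eventually (\<lambda>a. 0 < s * r * (1 + a * r)\<^sup>2 - (1 - r\<^sup>2) * (1 - a * r)) (at_left 1)"
    by (rule order_tendstoD)
  moreover have "eventually (\<lambda>a::real. a \<in> {0<..<1}) (at_left 1)"
    by (rule eventually_at_left_real) simp
  ultimately have "eventually (\<lambda>a. a \<in> {0<..<1} \<and> 0 < s * r * (1 + a * r)\<^sup>2 - (1 - r\<^sup>2) * (1 - a * r)) (at_left 1)"
    by eventually_elim simp
  then obtain a where a: "0 < a" "a < 1" and gt: "(1 - r\<^sup>2) * (1 - a * r) < s * r * (1 + a * r)\<^sup>2"
    using eventually_happens'[OF trivial_limit_at_left_real] by force
  have pos: "0 < 1 + a * r" "0 < 1 - a * r"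
    using a r mult_strict_mono'[of a 1 r 1] by (auto intro: add_pos_nonneg)
  have "(1 - r\<^sup>2) / (1 + a * r)\<^sup>2 < s * r / (1 - a * r)"
    using gt pos by (simp add: pos_less_divide_eq pos_divide_less_eq)
  then have "(1 - a\<^sup>2) * ((1 - r\<^sup>2) / (1 + a * r)\<^sup>2) < (1 - a\<^sup>2) * (s * r / (1 - a * r))"
    using a by (intro mult_strict_left_mono) (auto simp: power_less_one_iff abs_square_less_1)
  also have "\<dots> = s * (1 - a\<^sup>2) * r / (1 - a * r)" by simp
  also have "(1 - a\<^sup>2) * ((1 - r\<^sup>2) / (1 + a * r)\<^sup>2) = 1 - ((a + r) / (1 + a * r))\<^sup>2"
  proof -
    have "(1 + a * r)\<^sup>2 - (a + r)\<^sup>2 = (1 - a\<^sup>2) * (1 - r\<^sup>2)" by (simp add: power2_eq_square algebra_simps)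
    moreover have "1 - ((a + r) / (1 + a * r))\<^sup>2 = ((1 + a * r)\<^sup>2 - (a + r)\<^sup>2) / (1 + a * r)\<^sup>2"
      using pos by (simp add: power_divide diff_divide_distrib)
    ultimately show ?thesis by simp
  qed
  finally show ?thesis using a by (intro that) auto
qed

text \<open>The second inequality is not homogeneous in h: at z = 0 it already fails if |h 0|^2
  exceeds the sup norm, which happens for large multiples of an extremal map. This is why it is
  stated for sup norm at most 1; the extremal maps obey the same restriction.\<close>

theorem theorem3p3:
  fixes K k :: real
  assumes "K \<ge> 1" and "k = (K - 1) / (K + 1)"
  shows
    "k \<in> {0..<1} \<and>
     (\<exists>r1. {r\<in>{0<..<1}. 2 * (k + 1) * r * (1 + r) - (1 - r)\<^sup>2 = 0} = {r1} \<and>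
        (\<forall>a b h g z. qc_harmonic_series K a b h g \<and> z \<in> unit_disc \<and> norm z \<le> r1 \<longrightarrow>
            summable (majorant_term a b (norm z)) \<and>
            norm (h z) + (\<Sum>n. majorant_term a b (norm z) n) \<le> disc_sup_norm h) \<and>
        (\<forall>R>r1. \<exists>a b h g z. qc_harmonic_series K a b h g \<and> z \<in> unit_disc \<and> norm z \<le> R \<and>
            norm (h z) + (\<Sum>n. majorant_term a b (norm z) n) > disc_sup_norm h)) \<and>
     (\<exists>r2. {r\<in>{0<..<1}. (k + 1) * r * (1 + r) - (1 - r)\<^sup>2 = 0} = {r2} \<and>
        (\<forall>a b h g z. qc_harmonic_series K a b h g \<and> disc_sup_norm h \<le> 1 \<and>
              z \<in> unit_disc \<and> norm z \<le> r2 \<longrightarrow>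
            summable (majorant_term a b (norm z)) \<and>
            (norm (h z))\<^sup>2 + (\<Sum>n. majorant_term a b (norm z) n) \<le> disc_sup_norm h) \<and>
        (\<forall>R>r2. \<exists>a b h g z. qc_harmonic_series K a b h g \<and> disc_sup_norm h \<le> 1 \<and>
              z \<in> unit_disc \<and> norm z \<le> R \<and>
            (norm (h z))\<^sup>2 + (\<Sum>n. majorant_term a b (norm z) n) > disc_sup_norm h))"
proof (intro conjI)
  have k: "0 \<le> k" "k < 1" using assms by auto
  then show "k \<in> {0..<1}" by simp
  \<comment> \<open>R may be 1 or larger while the test point has to lie in the disc. As the root is
    at most 1/3, the minimum of R and 1/2 is an admissible radius.\<close>
  have between: "\<exists>r. r0 < r \<and> r < 1 \<and> r \<le> R" if "r0 \<le> 1 / 3" "r0 < R" for r0 R :: real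
    using that by (intro exI[of _ "min R (1 / 2)"]) auto
  show "\<exists>r1. {r\<in>{0<..<1}. 2 * (k + 1) * r * (1 + r) - (1 - r)\<^sup>2 = 0} = {r1} \<and>
        (\<forall>a b h g z. qc_harmonic_series K a b h g \<and> z \<in> unit_disc \<and> norm z \<le> r1 \<longrightarrow>
            summable (majorant_term a b (norm z)) \<and>
            norm (h z) + (\<Sum>n. majorant_term a b (norm z) n) \<le> disc_sup_norm h) \<and>
        (\<forall>R>r1. \<exists>a b h g z. qc_harmonic_series K a b h g \<and> z \<in> unit_disc \<and> norm z \<le> R \<and>
            norm (h z) + (\<Sum>n. majorant_term a b (norm z) n) > disc_sup_norm h)"
  proof -
    obtain r1 where r1: "{r\<in>{0<..<1}. 2 * (k + 1) * r * (1 + r) - (1 - r)\<^sup>2 = 0} = {r1}"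
      "0 < r1" "r1 \<le> 1 / 3"
      "\<And>r. 0 \<le> r \<Longrightarrow> r \<le> r1 \<Longrightarrow> 2 * (k + 1) * r * (1 + r) \<le> (1 - r)\<^sup>2"
      "\<And>r. r1 < r \<Longrightarrow> r < 1 \<Longrightarrow> 2 * (k + 1) * r * (1 + r) > (1 - r)\<^sup>2"
      using radius_equation[of "2 * (k + 1)"] k by auto
    show ?thesis
    proof (intro exI[of _ r1] conjI r1(1) allI impI)
      fix a b h g and z :: complex
      assume *: "qc_harmonic_series K a b h g \<and> z \<in> unit_disc \<and> norm z \<le> r1"
      then have z: "norm z \<le> 1 / 3" using r1(3) by simp
      obtain M t where Mt: "M = disc_sup_norm h" "M > 0" "0 \<le> t" "t \<le> 1"
        "summable (majorant_term a b (norm z))"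
        "norm (h z) \<le> M * ((t + norm z) / (1 + t * norm z))"
        "(\<Sum>n. majorant_term a b (norm z) n) \<le> M * ((k + 1) * (1 - t\<^sup>2) * (norm z / (1 - norm z)))"
        using qc_harmonic_series_bounds[OF conjunct1[OF *] assms z] by metis
      show "summable (majorant_term a b (norm z))" by (rule Mt(5))
      have "(t + norm z) / (1 + t * norm z) + (k + 1) * (1 - t\<^sup>2) * (norm z / (1 - norm z)) \<le> 1"
        using r1(4)[of "norm z"] * z k Mt by (intro schwarz_majorant_ineq) auto
      then have "M * ((t + norm z) / (1 + t * norm z) + (k + 1) * (1 - t\<^sup>2) * (norm z / (1 - norm z))) \<le> M * 1"
        using Mt(2) by (intro mult_left_mono) auto
      then show "norm (h z) + (\<Sum>n. majorant_term a b (norm z) n) \<le> disc_sup_norm h"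
        using Mt(6,7) unfolding distrib_left Mt(1) by linarith
    next
      fix R assume "r1 < R"
      then obtain r where r: "r1 < r" "r < 1" "r \<le> R" using between[OF r1(3)] by blast
      then have r0: "0 < r" using r1(2) by simp
      obtain a where a: "0 < a" "a < 1" and gt: "(a + r) / (1 + a * r) + (k + 1) * (1 - a\<^sup>2) * r / (1 - a * r) > 1"
        using schwarz_majorant_exceeds_one[of "k + 1" r] r1(5)[OF r(1,2)] k r0 r(2) by auto
      show "\<exists>a b h g z. qc_harmonic_series K a b h g \<and> z \<in> unit_disc \<and> norm z \<le> R \<and>
          norm (h z) + (\<Sum>n. majorant_term a b (norm z) n) > disc_sup_norm h"
      proof (intro exI conjI)
        show "qc_harmonic_series K (extremal_coeff a) (\<lambda>n. of_real k * extremal_coeff a n)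
            (extremal_map a) (\<lambda>z. of_real k * (extremal_map a z - of_real a))"
          by (rule qc_harmonic_series_extremal[OF a assms])
        show "- of_real r \<in> unit_disc" "norm (- of_real r :: complex) \<le> R" using r r0 by auto
        have N: "norm (- of_real r :: complex) = r" using r0 by simp
        show "norm (extremal_map a (- of_real r)) + (\<Sum>n. majorant_term (extremal_coeff a)
            (\<lambda>n. of_real k * extremal_coeff a n) (norm (- of_real r :: complex)) n) > disc_sup_norm (extremal_map a)"
          unfolding N norm_extremal_map_neg[OF a less_imp_le[OF r0]]
            majorant_extremal[OF a less_imp_le[OF r0] r(2) k(1)] add.commute[of 1 k]
          using disc_sup_norm_extremal[OF a] gt by (rule le_less_trans)
      qed
    qed
  qed
  show "\<exists>r2. {r\<in>{0<..<1}. (k + 1) * r * (1 + r) - (1 - r)\<^sup>2 = 0} = {r2} \<and>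
        (\<forall>a b h g z. qc_harmonic_series K a b h g \<and> disc_sup_norm h \<le> 1 \<and>
              z \<in> unit_disc \<and> norm z \<le> r2 \<longrightarrow>
            summable (majorant_term a b (norm z)) \<and>
            (norm (h z))\<^sup>2 + (\<Sum>n. majorant_term a b (norm z) n) \<le> disc_sup_norm h) \<and>
        (\<forall>R>r2. \<exists>a b h g z. qc_harmonic_series K a b h g \<and> disc_sup_norm h \<le> 1 \<and>
              z \<in> unit_disc \<and> norm z \<le> R \<and>
            (norm (h z))\<^sup>2 + (\<Sum>n. majorant_term a b (norm z) n) > disc_sup_norm h)"
  proof -
    obtain r2 where r2: "{r\<in>{0<..<1}. (k + 1) * r * (1 + r) - (1 - r)\<^sup>2 = 0} = {r2}"
      "0 < r2" "r2 \<le> 1 / 3"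
      "\<And>r. 0 \<le> r \<Longrightarrow> r \<le> r2 \<Longrightarrow> (k + 1) * r * (1 + r) \<le> (1 - r)\<^sup>2"
      "\<And>r. r2 < r \<Longrightarrow> r < 1 \<Longrightarrow> (k + 1) * r * (1 + r) > (1 - r)\<^sup>2"
      using radius_equation[of "k + 1"] k by auto
    show ?thesis
    proof (intro exI[of _ r2] conjI r2(1) allI impI)
      fix a b h g and z :: complex
      assume *: "qc_harmonic_series K a b h g \<and> disc_sup_norm h \<le> 1 \<and> z \<in> unit_disc \<and> norm z \<le> r2"
      then have z: "norm z \<le> 1 / 3" using r2(3) by simp
      obtain M t where Mt: "M = disc_sup_norm h" "M > 0" "0 \<le> t" "t \<le> 1"
        "summable (majorant_term a b (norm z))"
        "norm (h z) \<le> M * ((t + norm z) / (1 + t * norm z))"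
        "(\<Sum>n. majorant_term a b (norm z) n) \<le> M * ((k + 1) * (1 - t\<^sup>2) * (norm z / (1 - norm z)))"
        using qc_harmonic_series_bounds[OF conjunct1[OF *] assms z] by metis
      show "summable (majorant_term a b (norm z))" by (rule Mt(5))
      have "(norm (h z))\<^sup>2 \<le> (M * ((t + norm z) / (1 + t * norm z)))\<^sup>2"
        by (rule power_mono[OF Mt(6)]) simp
      also have "\<dots> = M\<^sup>2 * ((t + norm z) / (1 + t * norm z))\<^sup>2" by (rule power_mult_distrib)
      \<comment> \<open>Here sup norm at most 1 enters, through M^2 <= M; afterwards M is a common
        factor of both terms.\<close>
      also have "\<dots> \<le> M * ((t + norm z) / (1 + t * norm z))\<^sup>2"
        using * Mt(1,2) by (intro mult_right_mono) (auto simp: power2_eq_square mult_left_le_one_le)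
      finally have h2: "(norm (h z))\<^sup>2 \<le> M * ((t + norm z) / (1 + t * norm z))\<^sup>2" .
      have "((t + norm z) / (1 + t * norm z))\<^sup>2 + (k + 1) * (1 - t\<^sup>2) * (norm z / (1 - norm z)) \<le> 1"
        using r2(4)[of "norm z"] * z k Mt by (intro schwarz_sq_majorant_ineq) auto
      then have "M * (((t + norm z) / (1 + t * norm z))\<^sup>2 + (k + 1) * (1 - t\<^sup>2) * (norm z / (1 - norm z))) \<le> M * 1"
        using Mt(2) by (intro mult_left_mono) auto
      then show "(norm (h z))\<^sup>2 + (\<Sum>n. majorant_term a b (norm z) n) \<le> disc_sup_norm h"
        using h2 Mt(7) unfolding distrib_left Mt(1) by linarith
    next
      fix R assume "r2 < R"
      then obtain r where r: "r2 < r" "r < 1" "r \<le> R" using between[OF r2(3)] by blast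
      then have r0: "0 < r" using r2(2) by simp
      obtain a where a: "0 < a" "a < 1" and gt: "((a + r) / (1 + a * r))\<^sup>2 + (k + 1) * (1 - a\<^sup>2) * r / (1 - a * r) > 1"
        using schwarz_sq_majorant_exceeds_one[of "k + 1" r] r2(5)[OF r(1,2)] k r0 r(2) by auto
      show "\<exists>a b h g z. qc_harmonic_series K a b h g \<and> disc_sup_norm h \<le> 1 \<and> z \<in> unit_disc \<and> norm z \<le> R \<and>
          (norm (h z))\<^sup>2 + (\<Sum>n. majorant_term a b (norm z) n) > disc_sup_norm h"
      proof (intro exI conjI)
        show "qc_harmonic_series K (extremal_coeff a) (\<lambda>n. of_real k * extremal_coeff a n)
            (extremal_map a) (\<lambda>z. of_real k * (extremal_map a z - of_real a))"
          by (rule qc_harmonic_series_extremal[OF a assms])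
        show "disc_sup_norm (extremal_map a) \<le> 1" by (rule disc_sup_norm_extremal[OF a])
        show "- of_real r \<in> unit_disc" "norm (- of_real r :: complex) \<le> R" using r r0 by auto
        have N: "norm (- of_real r :: complex) = r" using r0 by simp
        show "(norm (extremal_map a (- of_real r)))\<^sup>2 + (\<Sum>n. majorant_term (extremal_coeff a)
            (\<lambda>n. of_real k * extremal_coeff a n) (norm (- of_real r :: complex)) n) > disc_sup_norm (extremal_map a)"
          unfolding N norm_extremal_map_neg[OF a less_imp_le[OF r0]]
            majorant_extremal[OF a less_imp_le[OF r0] r(2) k(1)] add.commute[of 1 k]
          using disc_sup_norm_extremal[OF a] gt by (rule le_less_trans)
      qed
    qed
  qed
qed

end
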